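(* Let $d=\sum_{j=1}^r d_j\ge 3$ with $r\ge 3$ and integers $d_j\ge 1$, $j=1,\dots,r$. Let $V$ and $Y$ be real-valued $\Gamma$-periodic functions on $\mathbb{Z}^d$, and assume that $V$ is $(d_1,d_2,\dots,d_{r-1})\oplus d_r$-separable. Suppose further that for any $1\le i<m\le r-1$ and any $s\in I_i$, $t\in I_m$, there exist $\lambda_1=\lambda_1(s,t)\in\mathbb{C}$, $\lambda_2=\lambda_2(s,t)\in\mathbb{C}$ and a set $S=S(s,t)\subset\{1,2,\dots,d\}$ with $s,t\in S$ and $\#S\ge 3$, such that $V$ and $Y$ are generalized partially Fermi isospectral with respect to $(S,\lambda_1,\lambda_2)$. Then $Y$ is also $(d_1,d_2,\dots,d_{r-1})\oplus d_r$-separable.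
   Context: Let $q_1,\dots,q_d$ be pairwise coprime positive integers, $\Gamma=q_1\mathbb{Z}\oplus\cdots\oplus q_d\mathbb{Z}$, $Q=q_1q_2\cdots q_d$. A function $V:\mathbb{Z}^d\to\mathbb{C}$ is $\Gamma$-periodic if $V(n+\gamma)=V(n)$ for all $n\in\mathbb{Z}^d$, $\gamma\in\Gamma$. The discrete Laplacian is $(\Delta u)(n)=\sum_{\|n'-n\|=1}u(n')$ with $\|n'-n\|=\sum_{l=1}^d|n_l-n'_l|$. For $k=(k_1,\dots,k_d)$, the functions $u:\mathbb{Z}^d\to\mathbb{C}$ satisfying the Floquet-Bloch condition $u(n+q_j\mathbf{e}_j)=e^{2\pi \mathrm{i}k_j}u(n)$ for all $n\in\mathbb{Z}^d$, $j=1,\dots,d$ ($\mathbf{e}_j$ the standard basis) form a $Q$-dimensional space, each such $u$ being determined by its values on $W=\{n\in\mathbb{Z}^d:0\le n_j\le q_j-1,\ j=1,\dots,d\}$. For $\Gamma$-periodic $V$ the operator $\Delta+V$ preserves this space, and $D_V(k)$ denotes the $Q\times Q$ matrix of its restriction in the coordinates $(u(n))_{n\in W}$. Put $P_V(k,\lambda)=\det(D_V(k)-\lambda I)$. Generalized partial Fermi isospectrality ($d\ge2$): for a non-empty set $S\subset\{1,\dots,d\}$ and $\lambda_1,\lambda_2\in\mathbb{C}$, two $\Gamma$-periodic functions $V$ and $Y$ are generalized partially Fermi isospectral with respect to $(S,\lambda_1,\lambda_2)$ if there exist $k_j^*\in\mathbb{R}$ for each $j\in\{1,\dots,d\}\setminus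 S$ such that for all choices of $k_j\in\mathbb{R}$, $j\in S$, one has $P_V(k,\lambda_1)=P_Y(k,\lambda_2)$, where $k=(k_1,\dots,k_d)$ with $k_j=k_j^*$ for $j\notin S$. Blocks: put $d_0=0$ and, for $m=1,\dots,r$, $I_m=\{1+\sum_{j=0}^{m-1}d_j,\ 2+\sum_{j=0}^{m-1}d_j,\dots,\sum_{j=0}^{m}d_j\}$; for $n\in\mathbb{Z}^d$ let $\tilde n_m\in\mathbb{Z}^{d_m}$ be the vector of the components of $n$ with indices in $I_m$, so $n=(\tilde n_1,\dots,\tilde n_r)$. A function $V:\mathbb{Z}^d\to\mathbb{C}$ is $(d_1,\dots,d_{r-1})\oplus d_r$-separable if there exist functions $V_j:\mathbb{Z}^{d_j+d_r}\to\mathbb{C}$, $j=1,\dots,r-1$, such that $V(n)=V_1(\tilde n_1,\tilde n_r)+V_2(\tilde n_2,\tilde n_r)+\cdots+V_{r-1}(\tilde n_{r-1},\tilde n_r)$ for all $n\in\mathbb{Z}^d$. *)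

theory Defs
  imports Complex_Main "Jordan_Normal_Form.Determinant"
begin

text \<open>
  Points of \<open>\<int>\<^sup>d\<close> are the elements of \<^term>\<open>carrier_vec d :: int vec set\<close>; coordinates are numbered
  \<open>0, \<dots>, d - 1\<close> instead of \<open>1, \<dots>, d\<close>. A function on \<open>\<int>\<^sup>d\<close> is a total function on \<open>int vec\<close> of
  which only the values on \<open>carrier_vec d\<close> matter.
\<close>

definition period_lattice :: "nat \<Rightarrow> (nat \<Rightarrow> nat) \<Rightarrow> int vec set" where
  "period_lattice d q = {g \<in> carrier_vec d. \<forall>j<d. int (q j) dvd g $ j}"

definition periodic :: "nat \<Rightarrow> (nat \<Rightarrow> nat) \<Rightarrow> (int vec \<Rightarrow> complex) \<Rightarrow> bool" where
  "periodic d q V \<longleftrightarrow> (\<forall>n\<in>carrier_vec d. \<forall>g\<in>period_lattice d q. V (n + g) = V n)"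

definition neighbours :: "nat \<Rightarrow> int vec \<Rightarrow> int vec set" where
  "neighbours d n = {n' \<in> carrier_vec d. (\<Sum>l<d. \<bar>n $ l - n' $ l\<bar>) = 1}"

definition laplacian :: "nat \<Rightarrow> (int vec \<Rightarrow> complex) \<Rightarrow> int vec \<Rightarrow> complex" where
  "laplacian d u n = (\<Sum>n'\<in>neighbours d n. u n')"

definition schroedinger ::
    "nat \<Rightarrow> (int vec \<Rightarrow> complex) \<Rightarrow> (int vec \<Rightarrow> complex) \<Rightarrow> int vec \<Rightarrow> complex" where
  "schroedinger d V u n = laplacian d u n + V n * u n"

definition floquet ::
    "nat \<Rightarrow> (nat \<Rightarrow> nat) \<Rightarrow> (nat \<Rightarrow> real) \<Rightarrow> (int vec \<Rightarrow> complex) \<Rightarrow> bool" where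
  "floquet d q k u \<longleftrightarrow>
     (\<forall>n\<in>carrier_vec d. \<forall>j<d.
        u (n + int (q j) \<cdot>\<^sub>v unit_vec d j) = exp (2 * pi * \<i> * k j) * u n)"

definition fundamental_domain :: "nat \<Rightarrow> (nat \<Rightarrow> nat) \<Rightarrow> int vec set" where
  "fundamental_domain d q = {n \<in> carrier_vec d. \<forall>j<d. 0 \<le> n $ j \<and> n $ j \<le> int (q j) - 1}"

text \<open>Library matrices are indexed by numbers, so the fundamental domain is listed
  (lexicographically); the determinant below does not depend on the chosen order.\<close>

definition domain_list :: "nat \<Rightarrow> (nat \<Rightarrow> nat) \<Rightarrow> int vec list" where
  "domain_list d q = map vec_of_list (product_lists (map (\<lambda>j. [0..int (q j) - 1]) [0..<d]))"

definition residue_point :: "nat \<Rightarrow> (nat \<Rightarrow> nat) \<Rightarrow> int vec \<Rightarrow> int vec" where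
  "residue_point d q n = vec d (\<lambda>j. n $ j mod int (q j))"

text \<open>The Floquet-Bloch function with prescribed values \<open>f\<close> on the fundamental domain. That it is
  the only one is shown in \<open>floquet_ext_floquet\<close>, \<open>floquet_ext_domain\<close> and \<open>floquet_ext_unique\<close>.\<close>

definition floquet_ext ::
    "nat \<Rightarrow> (nat \<Rightarrow> nat) \<Rightarrow> (nat \<Rightarrow> real) \<Rightarrow> (int vec \<Rightarrow> complex) \<Rightarrow> int vec \<Rightarrow> complex" where
  "floquet_ext d q k f n =
     exp (2 * pi * \<i> * complex_of_real (\<Sum>j<d. k j * of_int (n $ j div int (q j)))) *
     f (residue_point d q n)"

text \<open>Column \<open>b\<close> holds the coordinates of the image of the Floquet-Bloch function whose coordinate
  vector is the \<open>b\<close>-th standard basis vector; see \<open>floquet_matrix_correct\<close>.\<close>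

definition floquet_matrix ::
    "nat \<Rightarrow> (nat \<Rightarrow> nat) \<Rightarrow> (int vec \<Rightarrow> complex) \<Rightarrow> (nat \<Rightarrow> real) \<Rightarrow> complex mat" where
  "floquet_matrix d q V k =
     (let Q = \<Prod>j<d. q j; W = domain_list d q in
      mat Q Q (\<lambda>(a, b). schroedinger d V
        (floquet_ext d q k (\<lambda>n. if n = W ! b then 1 else 0)) (W ! a)))"

definition floquet_det ::
    "nat \<Rightarrow> (nat \<Rightarrow> nat) \<Rightarrow> (int vec \<Rightarrow> complex) \<Rightarrow> (nat \<Rightarrow> real) \<Rightarrow> complex \<Rightarrow> complex" where
  "floquet_det d q V k z = det (floquet_matrix d q V k - z \<cdot>\<^sub>m 1\<^sub>m (\<Prod>j<d. q j))"

definition partially_fermi_isospectral ::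
    "nat \<Rightarrow> (nat \<Rightarrow> nat) \<Rightarrow> nat set \<Rightarrow> complex \<Rightarrow> complex \<Rightarrow>
     (int vec \<Rightarrow> complex) \<Rightarrow> (int vec \<Rightarrow> complex) \<Rightarrow> bool" where
  "partially_fermi_isospectral d q S z1 z2 V Y \<longleftrightarrow>
     (\<exists>k0 :: nat \<Rightarrow> real. \<forall>k :: nat \<Rightarrow> real.
        floquet_det d q V (\<lambda>j. if j \<in> S then k j else k0 j) z1 =
        floquet_det d q Y (\<lambda>j. if j \<in> S then k j else k0 j) z2)"

text \<open>Blocks are numbered from \<open>1\<close>, with sizes \<open>D 1, D 2, \<dots>\<close>; \<open>D 0\<close> is not used.\<close>

definition block_start :: "(nat \<Rightarrow> nat) \<Rightarrow> nat \<Rightarrow> nat" where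
  "block_start D m = (\<Sum>j=1..<m. D j)"

definition block :: "(nat \<Rightarrow> nat) \<Rightarrow> nat \<Rightarrow> nat set" where
  "block D m = {block_start D m ..< block_start D m + D m}"

definition block_part :: "(nat \<Rightarrow> nat) \<Rightarrow> nat \<Rightarrow> int vec \<Rightarrow> int vec" where
  "block_part D m n = vec (D m) (\<lambda>i. n $ (block_start D m + i))"

definition separable :: "(nat \<Rightarrow> nat) \<Rightarrow> nat \<Rightarrow> (int vec \<Rightarrow> complex) \<Rightarrow> bool" where
  "separable D r V \<longleftrightarrow>
     (\<exists>Vs :: nat \<Rightarrow> int vec \<Rightarrow> complex. \<forall>n\<in>carrier_vec (\<Sum>j=1..r. D j).
        V n = (\<Sum>m=1..r-1. Vs m (block_part D m n @\<^sub>v block_part D r n)))"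


subsection \<open>Adequacy of the encoding\<close>

lemma finite_neighbours: "finite (neighbours d n)"
proof -
  have "neighbours d n \<subseteq> vec_of_list ` {xs. length xs = d \<and> set xs \<subseteq> (\<Union>l<d. {n $ l - 1 .. n $ l + 1})}"
  proof
    fix x assume x: "x \<in> neighbours d n"
    have dx: "dim_vec x = d" using x by (auto simp: neighbours_def)
    have b: "\<bar>n $ l - x $ l\<bar> \<le> 1" if "l < d" for l
    proof -
      have "\<bar>n $ l - x $ l\<bar> \<le> (\<Sum>l<d. \<bar>n $ l - x $ l\<bar>)"
        by (rule member_le_sum) (use that in auto)
      then show ?thesis using x by (simp add: neighbours_def)
    qed
    have "set (list_of_vec x) \<subseteq> (\<Union>l<d. {n $ l - 1 .. n $ l + 1})"
    proof
      fix y assume "y \<in> set (list_of_vec x)"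
      then obtain l where "l < d" "y = x $ l"
        using dx by (metis in_set_conv_nth length_list_of_vec list_of_vec_index)
      then show "y \<in> (\<Union>l<d. {n $ l - 1 .. n $ l + 1})" using b[of l] by (auto intro!: bexI[of _ l])
    qed
    then show "x \<in> vec_of_list ` {xs. length xs = d \<and> set xs \<subseteq> (\<Union>l<d. {n $ l - 1 .. n $ l + 1})}"
      using dx by (intro image_eqI[of _ _ "list_of_vec x"]) (auto simp: vec_list)
  qed
  moreover have "finite {xs. length xs = d \<and> set xs \<subseteq> (\<Union>l<d. {n $ l - 1 .. n $ l + 1})}"
    using finite_lists_length_eq[of "\<Union>l<d. {n $ l - 1 .. n $ l + 1}" d] by (simp add: conj_commute)
  ultimately show ?thesis by (meson finite_imageI finite_subset)
qed

lemma set_domain_list: "set (domain_list d q) = fundamental_domain d q"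
proof -
  have L: "xs \<in> set (product_lists (map (\<lambda>j. [0..int (q j) - 1]) [0..<d])) \<longleftrightarrow>
      length xs = d \<and> (\<forall>j<d. 0 \<le> xs ! j \<and> xs ! j \<le> int (q j) - 1)" for xs
    unfolding product_lists_set mem_Collect_eq list_all2_conv_all_nth by auto
  show ?thesis
  proof (intro equalityI subsetI)
    fix x assume "x \<in> set (domain_list d q)"
    then obtain xs where "x = vec_of_list xs" and
      "length xs = d" "\<forall>j<d. 0 \<le> xs ! j \<and> xs ! j \<le> int (q j) - 1"
      unfolding domain_list_def set_map image_iff using L by blast
    then show "x \<in> fundamental_domain d q"
      unfolding fundamental_domain_def carrier_vec_def by (simp add: vec_of_list_index)
  next
    fix x assume "x \<in> fundamental_domain d q"
    then have "list_of_vec x \<in> set (product_lists (map (\<lambda>j. [0..int (q j) - 1]) [0..<d]))"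
      unfolding L by (simp add: fundamental_domain_def list_of_vec_index)
    then show "x \<in> set (domain_list d q)"
      unfolding domain_list_def set_map by (intro image_eqI[of _ _ "list_of_vec x"]) (simp_all only: vec_list)
  qed
qed

lemma distinct_domain_list: "distinct (domain_list d q)"
  unfolding domain_list_def distinct_map
proof
  show "distinct (product_lists (map (\<lambda>j. [0..int (q j) - 1]) [0..<d]))"
    by (rule distinct_product_lists) simp
  show "inj_on vec_of_list (set (product_lists (map (\<lambda>j. [0..int (q j) - 1]) [0..<d])))"
    by (rule inj_on_inverseI[where g = list_of_vec]) (rule list_vec)
qed

lemma length_domain_list: "length (domain_list d q) = (\<Prod>j<d. q j)"
proof -
  have "length (product_lists xss) = prod_list (map length xss)" for xss :: "int list list"
    by (induction xss) (auto simp: length_concat comp_def sum_list_triv)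
  then show ?thesis
    by (simp add: domain_list_def comp_def prod.list_conv_set_nth atLeast0LessThan)
qed

lemma exp_turn_add:
  fixes a b :: real
  shows "exp (2 * pi * \<i> * (a + b)) = exp (2 * pi * \<i> * a) * exp (2 * pi * \<i> * b)"
  unfolding exp_add[symmetric] of_real_add distrib_left ..

lemma floquet_ext_floquet:
  assumes "\<forall>j<d. q j > 0"
  shows "floquet d q k (floquet_ext d q k f)"
  unfolding floquet_def
proof (intro ballI allI impI)
  fix n :: "int vec" and j assume n: "n \<in> carrier_vec d" and j: "j < d"
  let ?n = "n + int (q j) \<cdot>\<^sub>v unit_vec d j"
  have c: "?n $ l = n $ l + (if l = j then int (q j) else 0)" if "l < d" for l
    using that n j by (auto simp: unit_vec_def)
  have r: "residue_point d q ?n = residue_point d q n"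
    unfolding residue_point_def by (rule eq_vecI) (auto simp: c simp del: index_add_vec)
  have "(\<Sum>l<d. k l * of_int (?n $ l div int (q l))) =
        (\<Sum>l<d. k l * of_int (n $ l div int (q l)) + (if l = j then k j else 0))"
    using assms j by (intro sum.cong refl) (auto simp: c algebra_simps)
  also have "\<dots> = (\<Sum>l<d. k l * of_int (n $ l div int (q l))) + k j"
    using j by (simp add: sum.distrib)
  finally have s: "(\<Sum>l<d. k l * of_int (?n $ l div int (q l))) =
      (\<Sum>l<d. k l * of_int (n $ l div int (q l))) + k j" .
  show "floquet_ext d q k f ?n = exp (2 * pi * \<i> * k j) * floquet_ext d q k f n"
    unfolding floquet_ext_def r s exp_turn_add by (simp only: mult_ac)
qed

lemma residue_point_domain:
  assumes "n \<in> fundamental_domain d q"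
  shows "residue_point d q n = n"
  using assms by (intro eq_vecI) (auto simp: residue_point_def fundamental_domain_def)

lemma floquet_ext_domain:
  assumes "n \<in> fundamental_domain d q"
  shows "floquet_ext d q k f n = f n"
proof -
  have "(\<Sum>j<d. k j * of_int (n $ j div int (q j))) = 0"
    using assms by (intro sum.neutral) (auto simp: fundamental_domain_def)
  then show ?thesis using residue_point_domain[OF assms]
    by (simp add: floquet_ext_def del: of_real_sum)
qed

lemma floquet_shift:
  assumes u: "floquet d q k u" and n: "n \<in> carrier_vec d" and j: "j < d"
  shows "u (n + (c * int (q j)) \<cdot>\<^sub>v unit_vec d j) = exp (2 * pi * \<i> * (k j * of_int c)) * u n"
proof -
  let ?e = "exp (2 * pi * \<i> * k j)"
  define v :: "int \<Rightarrow> int vec" where "v c = n + (c * int (q j)) \<cdot>\<^sub>v unit_vec d j" for c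
  have vc: "v c \<in> carrier_vec d" for c using n by (auto simp: v_def)
  have step: "u (v (c + 1)) = ?e * u (v c)" for c
  proof -
    have "v (c + 1) = v c + int (q j) \<cdot>\<^sub>v unit_vec d j"
      using n j by (intro eq_vecI) (auto simp: v_def algebra_simps)
    then show ?thesis using u vc[of c] j by (simp add: floquet_def)
  qed
  have v0: "v 0 = n" using n j by (intro eq_vecI) (auto simp: v_def)
  have "u (v c) = exp (2 * pi * \<i> * (k j * of_int c)) * u n"
  proof (induction c rule: int_induct[where k = 0])
    case base then show ?case by (simp add: v0)
  next
    case (step1 i)
    have k: "k j * of_int (i + 1) = k j * of_int i + k j" by (simp add: algebra_simps)
    show ?case unfolding step step1 k exp_turn_add by (simp only: mult_ac)
  next
    case (step2 i)
    have k: "k j * of_int i = k j * of_int (i - 1) + k j" by (simp add: algebra_simps)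
    have "?e * u (v (i - 1)) = u (v i)" using step[of "i - 1"] by simp
    also have "\<dots> = ?e * (exp (2 * pi * \<i> * (k j * of_int (i - 1))) * u n)"
      unfolding step2 k exp_turn_add by (simp only: mult_ac)
    finally show ?case by simp
  qed
  then show ?thesis by (simp add: v_def)
qed

lemma floquet_ext_unique:
  assumes u: "floquet d q k u" and n: "n \<in> carrier_vec d"
  shows "u n = floquet_ext d q k u n"
proof -
  define w where "w i = vec d (\<lambda>j. if j < i then n $ j else n $ j mod int (q j))" for i
  have main: "u (w i) =
      exp (2 * pi * \<i> * complex_of_real (\<Sum>j<i. k j * of_int (n $ j div int (q j)))) * u (w 0)"
    if "i \<le> d" for i
    using that
  proof (induction i)
    case (Suc i)
    have "w (Suc i) = w i + ((n $ i div int (q i)) * int (q i)) \<cdot>\<^sub>v unit_vec d i"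
      using Suc.prems by (intro eq_vecI) (auto simp: w_def less_Suc_eq)
    then have 1: "u (w (Suc i)) = exp (2 * pi * \<i> * (k i * of_int (n $ i div int (q i)))) * u (w i)"
      using floquet_shift[OF u, of "w i" i] Suc.prems by (simp add: w_def)
    have 2: "u (w i) =
        exp (2 * pi * \<i> * complex_of_real (\<Sum>j<i. k j * of_int (n $ j div int (q j)))) * u (w 0)"
      using Suc by simp
    show ?case unfolding 1 2 sum.lessThan_Suc exp_turn_add by (simp only: mult_ac)
  qed simp
  have wd: "w d = n" using n by (intro eq_vecI) (auto simp: w_def)
  have w0: "w 0 = residue_point d q n" by (simp add: w_def residue_point_def)
  show ?thesis unfolding floquet_ext_def by (rule main[OF order_refl, unfolded wd w0])
qed

lemma schroedinger_floquet:
  assumes V: "periodic d q V" and u: "floquet d q k u"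
  shows "floquet d q k (schroedinger d V u)"
  unfolding floquet_def
proof (intro ballI allI impI)
  fix n :: "int vec" and j assume n: "n \<in> carrier_vec d" and j: "j < d"
  let ?g = "int (q j) \<cdot>\<^sub>v unit_vec d j :: int vec"
  let ?e = "exp (2 * pi * \<i> * k j)"
  have "?g \<in> period_lattice d q" using j by (auto simp: period_lattice_def unit_vec_def)
  then have Vn: "V (n + ?g) = V n" using V n by (auto simp: periodic_def)
  have un: "u (m + ?g) = ?e * u m" if "m \<in> carrier_vec d" for m
    using u that j by (simp add: floquet_def)
  have bij: "bij_betw (\<lambda>m. m + ?g) (neighbours d n) (neighbours d (n + ?g))"
  proof (rule bij_betwI[where g = "\<lambda>m. m - ?g"])
    show "(\<lambda>m. m + ?g) \<in> neighbours d n \<rightarrow> neighbours d (n + ?g)"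
      using n by (auto simp: neighbours_def)
    show "(\<lambda>m. m - ?g) \<in> neighbours d (n + ?g) \<rightarrow> neighbours d n"
      using n by (auto simp: neighbours_def algebra_simps)
    show "x + ?g - ?g = x" if "x \<in> neighbours d n" for x
      using that by (intro eq_vecI) (auto simp: neighbours_def)
    show "x - ?g + ?g = x" if "x \<in> neighbours d (n + ?g)" for x
      using that by (intro eq_vecI) (auto simp: neighbours_def)
  qed
  have "laplacian d u (n + ?g) = (\<Sum>m\<in>neighbours d n. u (m + ?g))"
    unfolding laplacian_def by (rule sum.reindex_bij_betw[OF bij, symmetric])
  also have "\<dots> = ?e * laplacian d u n"
    unfolding laplacian_def sum_distrib_left by (rule sum.cong) (auto simp: un neighbours_def)
  finally show "schroedinger d V u (n + ?g) = ?e * schroedinger d V u n"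
    using Vn un[OF n] by (simp add: schroedinger_def algebra_simps)
qed

lemma floquet_matrix_correct:
  assumes q: "\<forall>j<d. q j > 0" and u: "floquet d q k u"
  defines "Q \<equiv> \<Prod>j<d. q j" and "W \<equiv> domain_list d q"
  shows "vec Q (\<lambda>a. schroedinger d V u (W ! a)) =
         floquet_matrix d q V k *\<^sub>v vec Q (\<lambda>b. u (W ! b))"
proof (rule eq_vecI)
  have len: "length W = Q" by (simp add: W_def Q_def length_domain_list)
  have Wc: "x \<in> carrier_vec d" if "x \<in> set W" for x
    using that by (simp add: W_def set_domain_list fundamental_domain_def)
  define e where "e b = floquet_ext d q k (\<lambda>n. if n = W ! b then 1 else 0)" for b
  have ue: "u n = (\<Sum>b<Q. u (W ! b) * e b n)" if n: "n \<in> carrier_vec d" for n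
  proof -
    let ?x = "residue_point d q n"
    have "?x \<in> set W" using q
      by (auto simp: W_def set_domain_list fundamental_domain_def residue_point_def zle_diff1_eq)
    then obtain b0 where b0: "b0 < Q" "?x = W ! b0" using len by (metis in_set_conv_nth)
    have eqb: "W ! b0 = W ! b \<longleftrightarrow> b = b0" if "b < Q" for b
      using that b0 len distinct_domain_list[of d q] by (auto simp: W_def nth_eq_iff_index_eq)
    let ?E = "exp (2 * pi * \<i> * complex_of_real (\<Sum>j<d. k j * of_int (n $ j div int (q j))))"
    have "(\<Sum>b<Q. u (W ! b) * e b n) = (\<Sum>b<Q. if b = b0 then ?E * u (W ! b0) else 0)"
      using eqb by (intro sum.cong refl) (auto simp: e_def floquet_ext_def b0)
    also have "\<dots> = ?E * u ?x" using b0 by simp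
    also have "\<dots> = u n" using floquet_ext_unique[OF u n] by (simp add: floquet_ext_def)
    finally show ?thesis by simp
  qed
  fix a assume "a < dim_vec (floquet_matrix d q V k *\<^sub>v vec Q (\<lambda>b. u (W ! b)))"
  then have a: "a < Q" by (simp add: floquet_matrix_def Let_def Q_def)
  have Wa: "W ! a \<in> carrier_vec d" using Wc len a by simp
  have "schroedinger d V u (W ! a) = (\<Sum>b<Q. schroedinger d V (e b) (W ! a) * u (W ! b))"
  proof -
    have "laplacian d u (W ! a) = (\<Sum>m\<in>neighbours d (W ! a). \<Sum>b<Q. u (W ! b) * e b m)"
      unfolding laplacian_def by (rule sum.cong) (auto intro: ue simp: neighbours_def)
    also have "\<dots> = (\<Sum>b<Q. u (W ! b) * laplacian d (e b) (W ! a))"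
      unfolding laplacian_def sum_distrib_left by (rule sum.swap)
    finally have L: "laplacian d u (W ! a) = (\<Sum>b<Q. u (W ! b) * laplacian d (e b) (W ! a))" .
    have "V (W ! a) * u (W ! a) = (\<Sum>b<Q. u (W ! b) * (V (W ! a) * e b (W ! a)))"
      by (simp add: ue[OF Wa] sum_distrib_left mult_ac)
    then show ?thesis
      unfolding schroedinger_def L by (simp add: sum.distrib algebra_simps)
  qed
  then show "vec Q (\<lambda>a. schroedinger d V u (W ! a)) $ a =
      (floquet_matrix d q V k *\<^sub>v vec Q (\<lambda>b. u (W ! b))) $ a"
    using a by (simp add: floquet_matrix_def Let_def Q_def[symmetric] W_def[symmetric] e_def
        scalar_prod_def atLeast0LessThan)
qed (simp add: floquet_matrix_def Let_def Q_def)

end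

theory Submission
  imports Defs
begin

text \<open>
  Because the periods are pairwise coprime, the group of \<open>\<int>\<^sup>d\<close> modulo the period lattice is cyclic
  of order \<open>Q = q\<^sub>1 \<cdots> q\<^sub>d\<close>. A frequency is therefore a single integer \<open>a\<close> modulo \<open>Q\<close>, whose
  \<open>j\<close>-th component is \<open>a\<close> modulo \<open>q\<^sub>j\<close>. In these terms a periodic potential is separable iff its Fourier
  coefficient at \<open>a\<close> vanishes whenever \<open>q\<^sub>s\<close> and \<open>q\<^sub>t\<close> both fail to divide \<open>a\<close> for some \<open>s\<close>, \<open>t\<close> in two
  different blocks other than the last one (\<open>fourier_coeff_separable\<close>, \<open>separableI_fourier_coeff\<close>).

  In the basis of Bloch waves the Floquet matrix is the matrix of the coefficients
  \<open>c(m - n)\<close>, plus a diagonal with entries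
  \<open>\<Sum>\<^sub>j (\<omega>\<^sub>j\<^sup>n z\<^sub>j + 1 / (\<omega>\<^sub>j\<^sup>n z\<^sub>j))\<close>, where \<open>\<omega>\<^sub>j\<close> is a primitive \<open>q\<^sub>j\<close>-th root of unity
  and \<open>z\<^sub>j = e\<^bsup>2\<pi>ik\<^sub>j/q\<^sub>j\<^esup>\<close> (\<open>floquet_det_eq\<close>). Given \<open>s\<close> and \<open>t\<close>, pick a third index
  \<open>u\<close> in \<open>S\<close> and vary \<open>z\<^sub>s\<close>, \<open>z\<^sub>t\<close>, \<open>z\<^sub>u\<close> only. The determinants of \<open>V\<close> and \<open>Y\<close> are Laurent
  polynomials which agree on the torus, hence for all non-zero complex values
  (\<open>isospectral_imp_det_eq\<close>).

  Now fix a frequency \<open>l\<close> divisible neither by \<open>q\<^sub>s\<close> nor by \<open>q\<^sub>t\<close>, and let \<open>(z\<^sub>s, z\<^sub>t, z\<^sub>u)\<close> run to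
  infinity along a line whose direction is the cross product of \<open>(1, 1, 1)\<close> and
  \<open>(\<omega>\<^sub>s\<^sup>l, \<omega>\<^sub>t\<^sup>l, \<omega>\<^sub>u\<^sup>l)\<close>. The diagonal entries stay bounded for the frequencies congruent to \<open>0\<close> or to
  \<open>l\<close> modulo \<open>q\<^sub>s\<close>, \<open>q\<^sub>t\<close> and \<open>q\<^sub>u\<close>. By the offset of the line their limits can be given any
  values \<open>\<mu>\<close> and \<open>\<nu>\<close>, up to constants. All the other diagonal entries grow linearly: this is a statement
  about determinants of three triples on the unit circle (\<open>unit_circle_determinant\<close>), and it is here
  that three varying directions are needed. The rescaled determinants thus converge to
  polynomials in \<open>\<mu>\<close> and \<open>\<nu>\<close> with sums of principal minors as coefficients
  (\<open>det_add_diagonal_tendsto\<close>). The coefficient of bidegree one below the maximum in both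
  variables is a product of two traces, which other coefficients determine, minus the sum of
  \<open>c(m - n) c(n - m)\<close> over \<open>m \<equiv> 0\<close> and \<open>n \<equiv> l\<close> (\<open>off_diagonal_products_determined\<close>). For a real potential this is a sum of
  squared moduli. It vanishes for \<open>V\<close>, hence for \<open>Y\<close>, and one of its terms is
  the squared modulus of the coefficient of \<open>Y\<close> at \<open>l\<close>.
\<close>

section \<open>Determinants with a large diagonal\<close>

text \<open>A minor as a sum over permutations of an arbitrary index set: no renumbering of the
  rows is needed, so minors for different index sets can be added up.\<close>

definition principal_minor :: "('i \<Rightarrow> 'i \<Rightarrow> complex) \<Rightarrow> 'i set \<Rightarrow> complex" where
  "principal_minor A C = (\<Sum>p | p permutes C. of_int (sign p) * (\<Prod>i\<in>C. A i (p i)))"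

lemma det_eq_principal_minor: "det (mat n n (\<lambda>(i, j). A i j)) = principal_minor A {..<n}"
proof -
  have "mat n n (\<lambda>(i, j). A i j) $$ (i, p i) = A i (p i)" if "p permutes {..<n}" "i < n" for p i
    using that permutes_in_image[OF that(1), of i] by simp
  then show ?thesis
    unfolding principal_minor_def det_def by (simp add: atLeast0LessThan)
qed

text \<open>Multiply out the product over the rows, choosing in each row either the entry of \<open>A\<close> or the
  diagonal entry \<open>t i\<close>. If \<open>U\<close> is the set of rows where \<open>A\<close> was chosen, only
  permutations fixing everything outside \<open>U\<close> contribute, and they add up to the minor of \<open>U\<close>.\<close>

lemma principal_minor_add_diagonal:
  assumes "finite C"
  shows "principal_minor (\<lambda>i j. A i j + (if i = j then t i else 0)) C =
    (\<Sum>U\<in>Pow C. (\<Prod>i\<in>C - U. t i) * principal_minor A U)"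
proof -
  have fin: "finite U" if "U \<subseteq> C" for U using that assms finite_subset by blast
  have vanish: "(\<Prod>i\<in>C - U. if i = p i then t i else 0) =
      (if p permutes U then (\<Prod>i\<in>C - U. t i) else 0)"
    if U: "U \<subseteq> C" and p: "p permutes C" for U p
  proof (cases "p permutes U")
    case True
    then show ?thesis by (auto simp: permutes_not_in intro!: prod.cong)
  next
    case False
    then obtain i where "i \<in> C - U" "p i \<noteq> i" using permutes_superset[OF p] by blast
    then have "(\<Prod>i\<in>C - U. if i = p i then t i else 0) = 0"
      using assms by (intro prod_zero) (auto intro!: bexI[of _ i])
    then show ?thesis using False by simp
  qed
  have "principal_minor (\<lambda>i j. A i j + (if i = j then t i else 0)) C =
      (\<Sum>p | p permutes C. \<Sum>U\<in>Pow C. of_int (sign p) * ((\<Prod>i\<in>U. A i (p i)) *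
        (if p permutes U then (\<Prod>i\<in>C - U. t i) else 0)))"
    unfolding principal_minor_def prod_add[OF assms] sum_distrib_left
    by (intro sum.cong refl) (auto simp: vanish)
  also have "\<dots> = (\<Sum>U\<in>Pow C. \<Sum>p | p permutes C. of_int (sign p) * ((\<Prod>i\<in>U. A i (p i)) *
        (if p permutes U then (\<Prod>i\<in>C - U. t i) else 0)))"
    by (rule sum.swap)
  also have "\<dots> = (\<Sum>U\<in>Pow C. (\<Prod>i\<in>C - U. t i) * principal_minor A U)"
  proof (rule sum.cong[OF refl])
    fix U assume U: "U \<in> Pow C"
    have "(\<Sum>p | p permutes C. of_int (sign p) * ((\<Prod>i\<in>U. A i (p i)) *
          (if p permutes U then (\<Prod>i\<in>C - U. t i) else 0))) =
        (\<Sum>p | p permutes U. (\<Prod>i\<in>C - U. t i) * (of_int (sign p) * (\<Prod>i\<in>U. A i (p i))))"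
      using U assms
      by (intro sum.mono_neutral_cong_right)
        (auto simp: finite_permutations permutes_subset mult_ac)
    then show "(\<Sum>p | p permutes C. of_int (sign p) * ((\<Prod>i\<in>U. A i (p i)) *
          (if p permutes U then (\<Prod>i\<in>C - U. t i) else 0))) =
        (\<Prod>i\<in>C - U. t i) * principal_minor A U"
      by (simp add: principal_minor_def sum_distrib_left)
  qed
  finally show ?thesis .
qed

lemma principal_minor_singleton: "principal_minor A {i} = A i i"
  by (simp add: principal_minor_def)

lemma principal_minor_pair:
  assumes "i \<noteq> j"
  shows "principal_minor A {i, j} = A i i * A j j - A i j * A j i"
proof -
  have "{p. p permutes {i, j}} = {id, Transposition.transpose i j}"
    by (auto simp: permutes_doubleton_iff)
  moreover have "id \<noteq> Transposition.transpose i j"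
    using assms by (metis id_apply transpose_apply_first)
  ultimately show ?thesis
    using assms by (simp add: principal_minor_def sign_swap_id sign_id)
qed

text \<open>Expand in minors and distribute the normalising factors \<open>x L i\<close> over the rows with growing
  diagonal. A term survives in the limit only if it takes the diagonal entry in each of these rows,
  that is, if its minor is indexed by a subset of \<open>C\<close>.\<close>

lemma det_add_diagonal_tendsto:
  fixes T :: "real \<Rightarrow> nat \<Rightarrow> complex"
  assumes C: "C \<subseteq> {..<N}"
    and bounded: "\<And>i. i \<in> C \<Longrightarrow> ((\<lambda>x. T x i) \<longlongrightarrow> \<tau> i) at_top"
    and growing: "\<And>i. i \<in> {..<N} - C \<Longrightarrow> ((\<lambda>x. T x i / of_real x) \<longlongrightarrow> L i) at_top"
    and nz: "\<And>i. i \<in> {..<N} - C \<Longrightarrow> L i \<noteq> 0"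
  shows "((\<lambda>x. det (mat N N (\<lambda>(i, j). A i j + (if i = j then T x i else 0))) /
            (\<Prod>i\<in>{..<N} - C. of_real x * L i)) \<longlongrightarrow>
          (\<Sum>U\<in>Pow C. (\<Prod>i\<in>C - U. \<tau> i) * principal_minor A U)) at_top"
proof -
  \<comment> \<open>contribution of row \<open>i\<close> to the \<open>U\<close>-th term of the expansion, with its share of the
    normalisation; \<open>f U i\<close> is its limit\<close>
  define F where "F U x i = (if i \<in> C then (if i \<in> U then 1 else T x i)
      else (if i \<in> U then 1 / (of_real x * L i) else T x i / (of_real x * L i)))" for U x i
  define f where "f U i = (if i \<in> C then (if i \<in> U then 1 else \<tau> i)
      else (if i \<in> U then 0 else 1))" for U i
  have inv0: "((\<lambda>x. 1 / of_real x :: complex) \<longlongrightarrow> 0) at_top"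
  proof -
    have "((\<lambda>x::real. complex_of_real (inverse x)) \<longlongrightarrow> of_real 0) at_top"
      by (intro tendsto_of_real tendsto_inverse_0_at_top filterlim_ident)
    then show ?thesis by (simp add: divide_inverse)
  qed
  have lim: "((\<lambda>x. F U x i) \<longlongrightarrow> f U i) at_top" if "i < N" for U i
  proof (cases "i \<in> C")
    case True
    then show ?thesis by (auto simp: F_def f_def bounded)
  next
    case False
    have "((\<lambda>x. (1 / of_real x) / L i) \<longlongrightarrow> 0 / L i) at_top"
      using False that nz by (intro tendsto_divide inv0 tendsto_const) auto
    moreover have "((\<lambda>x. (T x i / of_real x) / L i) \<longlongrightarrow> L i / L i) at_top"
      using False that nz by (intro tendsto_divide growing tendsto_const) auto
    ultimately show ?thesis using False that nz[of i] by (auto simp: F_def f_def)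
  qed
  have eq: "det (mat N N (\<lambda>(i, j). A i j + (if i = j then T x i else 0))) /
      (\<Prod>i\<in>{..<N} - C. of_real x * L i) =
      (\<Sum>U\<in>Pow {..<N}. (\<Prod>i<N. F U x i) * principal_minor A U)" for x
  proof -
    have "(\<Prod>i\<in>{..<N} - U. T x i) / (\<Prod>i\<in>{..<N} - C. of_real x * L i) = (\<Prod>i<N. F U x i)"
      if "U \<subseteq> {..<N}" for U
    proof -
      have "(\<Prod>i\<in>{..<N} - U. T x i) = (\<Prod>i<N. if i \<in> U then 1 else T x i)"
        by (subst prod.If_cases) (auto intro!: prod.cong)
      moreover have "(\<Prod>i\<in>{..<N} - C. of_real x * L i) =
          (\<Prod>i<N. if i \<in> C then 1 else of_real x * L i)"
        by (subst prod.If_cases) (auto intro!: prod.cong)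
      ultimately have "(\<Prod>i\<in>{..<N} - U. T x i) / (\<Prod>i\<in>{..<N} - C. of_real x * L i) =
          (\<Prod>i<N. (if i \<in> U then 1 else T x i) / (if i \<in> C then 1 else of_real x * L i))"
        by (simp only: prod_dividef)
      also have "\<dots> = (\<Prod>i<N. F U x i)" by (intro prod.cong) (auto simp: F_def)
      finally show ?thesis .
    qed
    then show ?thesis
      unfolding det_eq_principal_minor principal_minor_add_diagonal[OF finite_lessThan]
        sum_divide_distrib
      by (intro sum.cong refl) (simp flip: times_divide_eq_left)
  qed
  have "((\<lambda>x. \<Sum>U\<in>Pow {..<N}. (\<Prod>i<N. F U x i) * principal_minor A U) \<longlongrightarrow>
      (\<Sum>U\<in>Pow {..<N}. (\<Prod>i<N. f U i) * principal_minor A U)) at_top"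
    by (intro tendsto_sum tendsto_mult tendsto_const tendsto_prod lim) auto
  moreover have "(\<Sum>U\<in>Pow {..<N}. (\<Prod>i<N. f U i) * principal_minor A U) =
      (\<Sum>U\<in>Pow C. (\<Prod>i\<in>C - U. \<tau> i) * principal_minor A U)"
  proof (rule sum.mono_neutral_cong_right)
    show "\<forall>U\<in>Pow {..<N} - Pow C. (\<Prod>i<N. f U i) * principal_minor A U = 0"
      by (auto simp: f_def intro!: prod_zero)
    show "(\<Prod>i<N. f U i) * principal_minor A U = (\<Prod>i\<in>C - U. \<tau> i) * principal_minor A U"
      if "U \<in> Pow C" for U
    proof -
      have "(\<Prod>i<N. f U i) = (\<Prod>i\<in>C - U. \<tau> i)"
        using that C by (intro prod.mono_neutral_cong_right) (auto simp: f_def)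
      then show ?thesis by simp
    qed
  qed (use C in auto)
  ultimately show ?thesis unfolding eq by simp
qed

lemma sum_powers_eq_imp_coeffs_eq:
  fixes c c' :: "'a \<Rightarrow> complex" and e :: "'a \<Rightarrow> nat"
  assumes P: "finite P"
    and eq: "\<And>z. (\<Sum>U\<in>P. z ^ e U * c U) = (\<Sum>U\<in>P. z ^ e U * c' U)"
  shows "(\<Sum>U | U \<in> P \<and> e U = n. c U) = (\<Sum>U | U \<in> P \<and> e U = n. c' U)"
proof -
  have "poly (\<Sum>U\<in>P. monom (c U) (e U)) z = poly (\<Sum>U\<in>P. monom (c' U) (e U)) z" for z
    using eq[of z] by (simp add: poly_sum poly_monom mult.commute)
  then have "(\<Sum>U\<in>P. monom (c U) (e U)) = (\<Sum>U\<in>P. monom (c' U) (e U))"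
    by (simp add: poly_eq_poly_eq_iff[symmetric] fun_eq_iff)
  then have "coeff (\<Sum>U\<in>P. monom (c U) (e U)) n = coeff (\<Sum>U\<in>P. monom (c' U) (e U)) n"
    by simp
  moreover have "coeff (\<Sum>U\<in>P. monom (b U) (e U)) n = (\<Sum>U | U \<in> P \<and> e U = n. b U)"
    for b :: "'a \<Rightarrow> complex"
    using P by (simp add: coeff_sum sum.inter_filter)
  ultimately show ?thesis by simp
qed

text \<open>The coefficient of \<open>\<mu>\<^sup>m \<nu>\<^sup>n\<close> is the sum of the principal minors that omit \<open>m\<close> rows of \<open>I\<close> and
  \<open>n\<close> rows of \<open>J\<close>. Omitting all but one row yields the traces over \<open>I\<close> and over \<open>J\<close>. Omitting all
  but one row of each set yields the sum of the \<open>2 \<times> 2\<close> minors, which is the product of the two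
  traces minus the sum in question.\<close>

lemma off_diagonal_products_determined:
  assumes fin: "finite I" "finite J" and disj: "I \<inter> J = {}" and ne: "I \<noteq> {}" "J \<noteq> {}"
    and eq: "\<And>\<mu> \<nu>.
      (\<Sum>U\<in>Pow (I \<union> J). (\<Prod>i\<in>(I \<union> J) - U. if i \<in> I then \<mu> else \<nu>) * principal_minor A U) =
      (\<Sum>U\<in>Pow (I \<union> J). (\<Prod>i\<in>(I \<union> J) - U. if i \<in> I then \<mu> else \<nu>) * principal_minor B U)"
  shows "(\<Sum>i\<in>I. \<Sum>j\<in>J. A i j * A j i) = (\<Sum>i\<in>I. \<Sum>j\<in>J. B i j * B j i)"
proof -
  let ?P = "Pow (I \<union> J)"
  have monomial: "(\<Prod>i\<in>(I \<union> J) - U. if i \<in> I then \<mu> else \<nu>) = \<mu> ^ card (I - U) * \<nu> ^ card (J - U)"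
    for U and \<mu> \<nu> :: complex
  proof -
    have "(\<Prod>i\<in>(I \<union> J) - U. if i \<in> I then \<mu> else \<nu>) =
        (\<Prod>i\<in>I - U. if i \<in> I then \<mu> else \<nu>) * (\<Prod>i\<in>J - U. if i \<in> I then \<mu> else \<nu>)"
      using fin disj by (subst prod.union_disjoint[symmetric]) (auto intro!: prod.cong)
    also have "(\<Prod>i\<in>J - U. if i \<in> I then \<mu> else \<nu>) = (\<Prod>i\<in>J - U. \<nu>)"
      using disj by (intro prod.cong) auto
    finally show ?thesis by simp
  qed
  have coeffs: "(\<Sum>U | U \<in> {U \<in> ?P. card (I - U) = m} \<and> card (J - U) = n. principal_minor A U) =
      (\<Sum>U | U \<in> {U \<in> ?P. card (I - U) = m} \<and> card (J - U) = n. principal_minor B U)" for m n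
  proof (rule sum_powers_eq_imp_coeffs_eq)
    fix \<nu> :: complex
    show "(\<Sum>U | U \<in> ?P \<and> card (I - U) = m. \<nu> ^ card (J - U) * principal_minor A U) =
        (\<Sum>U | U \<in> ?P \<and> card (I - U) = m. \<nu> ^ card (J - U) * principal_minor B U)"
      by (rule sum_powers_eq_imp_coeffs_eq)
        (use fin eq[of _ \<nu>] in \<open>simp_all add: monomial mult.assoc\<close>)
  qed (use fin in auto)
  have split_card: "card (X - U) + card (X \<inter> U) = card X" if "finite X" for X U :: "'a set"
    using that card_Diff_subset_Int[of X U] card_mono[of X "X \<inter> U"] by simp
  have full: "card (X - U) = card X \<longleftrightarrow> X \<inter> U = {}" if "finite X" for X U :: "'a set"
  proof -
    have "card (X - U) = card X \<longleftrightarrow> card (X \<inter> U) = 0" using split_card[OF that, of U] by linarith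
    then show ?thesis using that by simp
  qed
  have one: "card (X - U) = card X - 1 \<longleftrightarrow> (\<exists>x. X \<inter> U = {x})"
    if "finite X" "X \<noteq> {}" for X U :: "'a set"
  proof -
    have "card X > 0" using that by (simp add: card_gt_0_iff)
    then have "card (X - U) = card X - 1 \<longleftrightarrow> card (X \<inter> U) = 1"
      using split_card[OF that(1), of U] by linarith
    then show ?thesis by (simp add: card_1_singleton_iff)
  qed
  have parts: "U = (I \<inter> U) \<union> (J \<inter> U)" if "U \<subseteq> I \<union> J" for U using that by blast
  have trace_J: "(\<Sum>j\<in>J. A j j) = (\<Sum>j\<in>J. B j j)"
  proof -
    have "{U. U \<in> {U \<in> ?P. card (I - U) = card I} \<and> card (J - U) = card J - 1} = (\<lambda>j. {j}) ` J"
    proof (intro equalityI subsetI)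
      fix U assume U: "U \<in> {U. U \<in> {U \<in> ?P. card (I - U) = card I} \<and> card (J - U) = card J - 1}"
      have "U \<subseteq> I \<union> J \<and> I \<inter> U = {} \<and> (\<exists>j. J \<inter> U = {j})"
        using U unfolding mem_Collect_eq Pow_iff full[OF fin(1)] one[OF fin(2) ne(2)] by simp
      then obtain j where "U \<subseteq> I \<union> J" "I \<inter> U = {}" "J \<inter> U = {j}" by blast
      then show "U \<in> (\<lambda>j. {j}) ` J" using parts[of U] by auto
    next
      fix U assume "U \<in> (\<lambda>j. {j}) ` J"
      then obtain j where "j \<in> J" "U = {j}" by blast
      moreover then have "I \<inter> U = {}" "J \<inter> U = {j}" using disj by auto
      ultimately show "U \<in> {U. U \<in> {U \<in> ?P. card (I - U) = card I} \<and> card (J - U) = card J - 1}"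
        unfolding mem_Collect_eq Pow_iff full[OF fin(1)] one[OF fin(2) ne(2)] by simp
    qed
    then show ?thesis using coeffs[of "card I" "card J - 1"]
      by (simp add: sum.reindex principal_minor_singleton)
  qed
  have trace_I: "(\<Sum>i\<in>I. A i i) = (\<Sum>i\<in>I. B i i)"
  proof -
    have "{U. U \<in> {U \<in> ?P. card (I - U) = card I - 1} \<and> card (J - U) = card J} = (\<lambda>i. {i}) ` I"
    proof (intro equalityI subsetI)
      fix U assume U: "U \<in> {U. U \<in> {U \<in> ?P. card (I - U) = card I - 1} \<and> card (J - U) = card J}"
      have "U \<subseteq> I \<union> J \<and> J \<inter> U = {} \<and> (\<exists>i. I \<inter> U = {i})"
        using U unfolding mem_Collect_eq Pow_iff full[OF fin(2)] one[OF fin(1) ne(1)] by simp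
      then obtain i where "U \<subseteq> I \<union> J" "J \<inter> U = {}" "I \<inter> U = {i}" by blast
      then show "U \<in> (\<lambda>i. {i}) ` I" using parts[of U] by auto
    next
      fix U assume "U \<in> (\<lambda>i. {i}) ` I"
      then obtain i where "i \<in> I" "U = {i}" by blast
      moreover then have "J \<inter> U = {}" "I \<inter> U = {i}" using disj by auto
      ultimately show "U \<in> {U. U \<in> {U \<in> ?P. card (I - U) = card I - 1} \<and> card (J - U) = card J}"
        unfolding mem_Collect_eq Pow_iff full[OF fin(2)] one[OF fin(1) ne(1)] by simp
    qed
    then show ?thesis using coeffs[of "card I - 1" "card J"]
      by (simp add: sum.reindex principal_minor_singleton)
  qed
  have "{U. U \<in> {U \<in> ?P. card (I - U) = card I - 1} \<and> card (J - U) = card J - 1} =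
      (\<lambda>(i, j). {i, j}) ` (I \<times> J)"
  proof (intro equalityI subsetI)
    fix U assume U: "U \<in> {U. U \<in> {U \<in> ?P. card (I - U) = card I - 1} \<and> card (J - U) = card J - 1}"
    have "U \<subseteq> I \<union> J \<and> (\<exists>i. I \<inter> U = {i}) \<and> (\<exists>j. J \<inter> U = {j})"
      using U unfolding mem_Collect_eq Pow_iff one[OF fin(1) ne(1)] one[OF fin(2) ne(2)] by simp
    then obtain i j where "U \<subseteq> I \<union> J" "I \<inter> U = {i}" "J \<inter> U = {j}" by blast
    then show "U \<in> (\<lambda>(i, j). {i, j}) ` (I \<times> J)" using parts[of U] by auto
  next
    fix U assume "U \<in> (\<lambda>(i, j). {i, j}) ` (I \<times> J)"
    then obtain i j where "i \<in> I" "j \<in> J" "U = {i, j}" by blast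
    moreover then have "I \<inter> U = {i}" "J \<inter> U = {j}" using disj by auto
    ultimately show "U \<in> {U. U \<in> {U \<in> ?P. card (I - U) = card I - 1} \<and> card (J - U) = card J - 1}"
      unfolding mem_Collect_eq Pow_iff one[OF fin(1) ne(1)] one[OF fin(2) ne(2)] by simp
  qed
  moreover have "inj_on (\<lambda>(i, j). {i, j}) (I \<times> J)"
    using disj by (auto simp: inj_on_def doubleton_eq_iff)
  ultimately have "(\<Sum>(i, j)\<in>I \<times> J. principal_minor A {i, j}) =
      (\<Sum>(i, j)\<in>I \<times> J. principal_minor B {i, j})"
    using coeffs[of "card I - 1" "card J - 1"] by (simp add: sum.reindex case_prod_unfold)
  moreover have "(\<Sum>(i, j)\<in>I \<times> J. principal_minor M {i, j}) =
      (\<Sum>i\<in>I. M i i) * (\<Sum>j\<in>J. M j j) - (\<Sum>i\<in>I. \<Sum>j\<in>J. M i j * M j i)" for M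
  proof -
    have "(\<Sum>(i, j)\<in>I \<times> J. principal_minor M {i, j}) =
        (\<Sum>i\<in>I. \<Sum>j\<in>J. M i i * M j j - M i j * M j i)"
      unfolding sum.cartesian_product using disj
      by (intro sum.cong) (auto intro!: principal_minor_pair)
    then show ?thesis by (simp add: sum_subtractf sum_product)
  qed
  ultimately show ?thesis using trace_I trace_J by simp
qed

section \<open>Laurent polynomials in one variable\<close>

text \<open>Negative powers are cleared by a power of \<open>z\<close>, so that zeros can be counted with ordinary
  polynomials.\<close>

definition laurent :: "(complex \<Rightarrow> complex) \<Rightarrow> bool" where
  "laurent f \<longleftrightarrow> (\<exists>p N. \<forall>z. z \<noteq> 0 \<longrightarrow> z ^ N * f z = poly p z)"

lemma laurent_const: "laurent (\<lambda>z. c)"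
  unfolding laurent_def by (rule exI[of _ "[:c:]"], rule exI[of _ 0]) simp

lemma laurent_ident: "laurent (\<lambda>z. z)"
  unfolding laurent_def by (rule exI[of _ "[:0, 1:]"], rule exI[of _ 0]) simp

lemma laurent_inverse: "laurent (\<lambda>z. 1 / z)"
  unfolding laurent_def by (rule exI[of _ "1"], rule exI[of _ 1]) simp

lemma laurent_mult:
  assumes "laurent f" "laurent g" shows "laurent (\<lambda>z. f z * g z)"
proof -
  obtain p M q N where f: "\<And>z. z \<noteq> 0 \<Longrightarrow> z ^ M * f z = poly p z"
    and g: "\<And>z. z \<noteq> 0 \<Longrightarrow> z ^ N * g z = poly q z"
    using assms by (auto simp: laurent_def)
  have "z ^ (M + N) * (f z * g z) = poly (p * q) z" if "z \<noteq> 0" for z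
    by (simp add: power_add mult_ac flip: f[OF that] g[OF that])
  then show ?thesis unfolding laurent_def by blast
qed

lemma laurent_add:
  assumes "laurent f" "laurent g" shows "laurent (\<lambda>z. f z + g z)"
proof -
  obtain p M q N where f: "\<And>z. z \<noteq> 0 \<Longrightarrow> z ^ M * f z = poly p z"
    and g: "\<And>z. z \<noteq> 0 \<Longrightarrow> z ^ N * g z = poly q z"
    using assms by (auto simp: laurent_def)
  have "z ^ (M + N) * (f z + g z) = poly (monom 1 N * p + monom 1 M * q) z" if "z \<noteq> 0" for z
    by (simp add: poly_monom power_add ring_distribs flip: f[OF that] g[OF that])
  then show ?thesis unfolding laurent_def by blast
qed

lemma laurent_sum:
  assumes "\<And>i. i \<in> A \<Longrightarrow> laurent (f i)" shows "laurent (\<lambda>z. \<Sum>i\<in>A. f i z)"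
  using assms
  by (induction A rule: infinite_finite_induct) (auto intro: laurent_const laurent_add)

lemma laurent_prod:
  assumes "\<And>i. i \<in> A \<Longrightarrow> laurent (f i)" shows "laurent (\<lambda>z. \<Prod>i\<in>A. f i z)"
  using assms
  by (induction A rule: infinite_finite_induct) (auto intro: laurent_const laurent_mult)

lemma laurent_det:
  assumes "\<And>i j. i < n \<Longrightarrow> j < n \<Longrightarrow> laurent (\<lambda>z. A z i j)"
  shows "laurent (\<lambda>z. det (mat n n (\<lambda>(i, j). A z i j)))"
proof -
  have eq: "det (mat n n (\<lambda>(i, j). A z i j)) =
      (\<Sum>p | p permutes {0..<n}. signof p * (\<Prod>i = 0..<n. A z i (p i)))" for z
    unfolding det_def by (auto intro!: sum.cong prod.cong dest: permutes_in_image[where x = i for i])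
  show ?thesis unfolding eq
    by (intro laurent_sum laurent_mult laurent_const laurent_prod assms)
      (auto dest: permutes_in_image[where x = i for i])
qed

lemma infinite_unit_circle: "infinite {z :: complex. cmod z = 1}"
proof -
  have "inj_on cis {0..pi}" 
    by (auto simp: inj_on_def complex_eq_iff intro: cos_inj_pi)
  moreover have "infinite {0..pi}" by (simp add: infinite_Icc)
  ultimately have "infinite (cis ` {0..pi})" using finite_imageD by blast
  then show ?thesis by (rule contrapos_nn) (auto elim: finite_subset[rotated])
qed

lemma laurent_eq_if_eq_on_unit_circle:
  assumes "laurent f" "laurent g" and eq: "\<And>z. cmod z = 1 \<Longrightarrow> f z = g z" and "z \<noteq> 0"
  shows "f z = g z"
proof -
  have "laurent (\<lambda>z. f z + (-1) * g z)"
    by (intro laurent_add laurent_mult laurent_const assms)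
  then obtain p N where p: "\<And>z. z \<noteq> 0 \<Longrightarrow> z ^ N * (f z - g z) = poly p z"
    by (auto simp: laurent_def)
  have "{z. cmod z = 1} \<subseteq> {z. poly p z = 0}"
  proof
    fix z :: complex assume z: "z \<in> {z. cmod z = 1}"
    then have "z \<noteq> 0" by auto
    then show "z \<in> {z. poly p z = 0}" using p[of z] eq[of z] z by simp
  qed
  then have "infinite {z. poly p z = 0}" using infinite_unit_circle finite_subset by blast
  then have "p = 0" using poly_roots_finite by blast
  then show ?thesis using p[OF \<open>z \<noteq> 0\<close>] \<open>z \<noteq> 0\<close> by simp
qed

section \<open>The Floquet matrix in the Fourier basis\<close>

text \<open>The pairing that makes \<open>x \<mapsto> cis (2 * pi * (a * phase d q x))\<close> the character with frequency \<open>a\<close>: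
  its \<open>j\<close>-th factor is the \<open>q j\<close>-th root of unity with exponent \<open>a x\<^sub>j\<close>. By the Chinese remainder
  theorem the frequencies \<open>0, \<dots>, Q - 1\<close> give every character once.\<close>

definition phase :: "nat \<Rightarrow> (nat \<Rightarrow> nat) \<Rightarrow> int vec \<Rightarrow> real" where
  "phase d q x = (\<Sum>j<d. of_int (x $ j) / of_nat (q j))"

definition fourier_coeff :: "nat \<Rightarrow> (nat \<Rightarrow> nat) \<Rightarrow> (int vec \<Rightarrow> complex) \<Rightarrow> int \<Rightarrow> complex" where
  "fourier_coeff d q V a =
     (\<Sum>x\<in>fundamental_domain d q. V x * cis (- (2 * pi * (of_int a * phase d q x)))) /
     of_nat (\<Prod>j<d. q j)"

definition bloch_wave :: "nat \<Rightarrow> (nat \<Rightarrow> nat) \<Rightarrow> (nat \<Rightarrow> real) \<Rightarrow> nat \<Rightarrow> int vec \<Rightarrow> complex" where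
  "bloch_wave d q k n x = cis (2 * pi * (\<Sum>j<d. (k j + real n) * of_int (x $ j) / of_nat (q j)))"

text \<open>The eigenvalue of the Laplacian on a Bloch wave. The set \<open>X\<close> of directions is a parameter in
  order to separate the directions that vary from those that are frozen.\<close>

definition symbol :: "nat set \<Rightarrow> (nat \<Rightarrow> nat) \<Rightarrow> (nat \<Rightarrow> complex) \<Rightarrow> nat \<Rightarrow> complex" where
  "symbol X q z n = (\<Sum>j\<in>X. cis (2 * pi * (real n / q j)) * z j + 1 / (cis (2 * pi * (real n / q j)) * z j))"

definition fourier_matrix ::
    "nat \<Rightarrow> (nat \<Rightarrow> nat) \<Rightarrow> (int vec \<Rightarrow> complex) \<Rightarrow> (nat \<Rightarrow> complex) \<Rightarrow> complex \<Rightarrow> complex mat" where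
  "fourier_matrix d q V z lam = mat (\<Prod>j<d. q j) (\<Prod>j<d. q j)
     (\<lambda>(i, j). fourier_coeff d q V (int i - int j) +
        (if i = j then symbol {..<d} q z i - lam else 0))"

lemma cis_eq_1_iff_Ints: "cis (2 * pi * t) = 1 \<longleftrightarrow> t \<in> \<int>"
proof
  assume "cis (2 * pi * t) = 1"
  then have "cos (2 * pi * t) = 1" by (simp add: complex_eq_iff)
  then obtain n :: int where "2 * pi * t = n * 2 * pi" by (auto simp: cos_one_2pi_int)
  then have "t = of_int n" by simp
  then show "t \<in> \<int>" by simp
qed simp

lemma cis_turn_add_Ints:
  assumes "m \<in> \<int>" shows "cis (2 * pi * (t + m)) = cis (2 * pi * t)"
  using assms by (simp add: distrib_left flip: cis_mult)

lemma neighbours_eq: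
  assumes n: "n \<in> carrier_vec d"
  shows "neighbours d n = (\<lambda>j. n + unit_vec d j) ` {..<d} \<union> (\<lambda>j. n - unit_vec d j) ` {..<d}"
proof (intro equalityI subsetI)
  fix x assume x: "x \<in> neighbours d n"
  then have xc: "x \<in> carrier_vec d" and s: "(\<Sum>l<d. \<bar>n $ l - x $ l\<bar>) = 1"
    by (auto simp: neighbours_def)
  then obtain j where j: "j < d" "n $ j \<noteq> x $ j"
    using sum.neutral[of "{..<d}" "\<lambda>l. \<bar>n $ l - x $ l\<bar>"] by fastforce
  have split: "\<bar>n $ j - x $ j\<bar> + (\<Sum>l\<in>{..<d} - {j}. \<bar>n $ l - x $ l\<bar>) = 1"
    using s j by (simp add: sum.remove[of "{..<d}" j])
  have "(\<Sum>l\<in>{..<d} - {j}. \<bar>n $ l - x $ l\<bar>) \<ge> 0" by (simp add: sum_nonneg)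
  then have rest: "(\<Sum>l\<in>{..<d} - {j}. \<bar>n $ l - x $ l\<bar>) = 0" and one: "\<bar>n $ j - x $ j\<bar> = 1"
    using split j by linarith+
  have off: "x $ l = n $ l" if "l < d" "l \<noteq> j" for l
  proof -
    have "\<bar>n $ l - x $ l\<bar> = 0"
      using rest that by (subst (asm) sum_nonneg_eq_0_iff) auto
    then show ?thesis by simp
  qed
  from one consider "x $ j = n $ j + 1" | "x $ j = n $ j - 1" by linarith
  then show "x \<in> (\<lambda>j. n + unit_vec d j) ` {..<d} \<union> (\<lambda>j. n - unit_vec d j) ` {..<d}"
  proof cases
    case 1
    then have "x = n + unit_vec d j" using xc n j off by (intro eq_vecI) (auto simp: unit_vec_def)
    then show ?thesis using j by blast
  next
    case 2
    then have "x = n - unit_vec d j" using xc n j off by (intro eq_vecI) (auto simp: unit_vec_def)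
    then show ?thesis using j by blast
  qed
next
  have one: "(\<Sum>l<d. \<bar>unit_vec d j $ l :: int\<bar>) = 1" if "j < d" for j
  proof -
    have "(\<Sum>l<d. \<bar>unit_vec d j $ l :: int\<bar>) = (\<Sum>l<d. if l = j then 1 else 0)"
      using that by (intro sum.cong) (auto simp: unit_vec_def)
    then show ?thesis using that by simp
  qed
  fix x assume "x \<in> (\<lambda>j. n + unit_vec d j) ` {..<d} \<union> (\<lambda>j. n - unit_vec d j) ` {..<d}"
  then obtain j where j: "j < d" and x: "x = n + unit_vec d j \<or> x = n - unit_vec d j" by blast
  have "(\<Sum>l<d. \<bar>n $ l - x $ l\<bar>) = (\<Sum>l<d. \<bar>unit_vec d j $ l :: int\<bar>)"
    using x n by (intro sum.cong) auto
  then show "x \<in> neighbours d n" using x n one[OF j] by (auto simp: neighbours_def)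
qed

lemma laplacian_eq:
  assumes n: "n \<in> carrier_vec d"
  shows "laplacian d u n = (\<Sum>j<d. u (n + unit_vec d j) + u (n - unit_vec d j))"
proof -
  have inj: "inj_on (\<lambda>j. n + unit_vec d j) {..<d}" "inj_on (\<lambda>j. n - unit_vec d j) {..<d}"
  proof -
    have "i = j" if "i < d" "j < d" "n + unit_vec d i = n + unit_vec d j" for i j
      using arg_cong[OF that(3), of "\<lambda>v. v $ i"] that(1,2) n by (auto simp: unit_vec_def split: if_splits)
    then show "inj_on (\<lambda>j. n + unit_vec d j) {..<d}" by (auto simp: inj_on_def)
    have "i = j" if "i < d" "j < d" "n - unit_vec d i = n - unit_vec d j" for i j
      using arg_cong[OF that(3), of "\<lambda>v. v $ i"] that(1,2) n by (auto simp: unit_vec_def split: if_splits)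
    then show "inj_on (\<lambda>j. n - unit_vec d j) {..<d}" by (auto simp: inj_on_def)
  qed
  have "n + unit_vec d i \<noteq> n - unit_vec d j" if "i < d" "j < d" for i j
  proof
    assume "n + unit_vec d i = n - unit_vec d j"
    from arg_cong[OF this, of "\<lambda>v. v $ i"] show False
      using that n by (auto simp: unit_vec_def split: if_splits)
  qed
  then have "(\<lambda>j. n + unit_vec d j) ` {..<d} \<inter> (\<lambda>j. n - unit_vec d j) ` {..<d} = {}" by auto
  then show ?thesis
    unfolding laplacian_def neighbours_eq[OF n]
    by (simp add: sum.union_disjoint sum.reindex inj sum.distrib)
qed

lemma bloch_wave_shift:
  assumes "x \<in> carrier_vec d" "j < d"
  shows "bloch_wave d q k n (x + c \<cdot>\<^sub>v unit_vec d j) =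
    cis (2 * pi * ((k j + real n) * of_int c / of_nat (q j))) * bloch_wave d q k n x"
proof -
  have "(\<Sum>l<d. (k l + real n) * of_int ((x + c \<cdot>\<^sub>v unit_vec d j) $ l) / of_nat (q l)) =
      (\<Sum>l<d. (k l + real n) * of_int (x $ l) / of_nat (q l) +
        (if l = j then (k j + real n) * of_int c / of_nat (q j) else 0))"
    using assms by (intro sum.cong refl) (auto simp: unit_vec_def algebra_simps add_divide_distrib)
  also have "\<dots> = (k j + real n) * of_int c / of_nat (q j) +
      (\<Sum>l<d. (k l + real n) * of_int (x $ l) / of_nat (q l))"
    using assms by (simp add: sum.distrib)
  finally show ?thesis by (simp only: bloch_wave_def distrib_left cis_mult)
qed

lemma laplacian_bloch_wave:
  assumes x: "x \<in> carrier_vec d"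
  shows "laplacian d (bloch_wave d q k n) x =
    symbol {..<d} q (\<lambda>j. cis (2 * pi * (k j / q j))) n * bloch_wave d q k n x"
proof -
  have "bloch_wave d q k n (x + unit_vec d j) + bloch_wave d q k n (x - unit_vec d j) =
      (cis (2 * pi * (real n / q j)) * cis (2 * pi * (k j / q j)) +
       1 / (cis (2 * pi * (real n / q j)) * cis (2 * pi * (k j / q j)))) * bloch_wave d q k n x"
    if j: "j < d" for j
  proof -
    have plus: "x + unit_vec d j = x + 1 \<cdot>\<^sub>v unit_vec d j" using x by (intro eq_vecI) auto
    have minus: "x - unit_vec d j = x + (-1) \<cdot>\<^sub>v unit_vec d j" using x by (intro eq_vecI) auto
    have c: "cis (2 * pi * (real n / q j)) * cis (2 * pi * (k j / q j)) =
        cis (2 * pi * ((k j + real n) / of_nat (q j)))"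
      unfolding cis_mult by (rule arg_cong[of _ _ cis]) (simp add: distrib_left add_divide_distrib)
    have inv: "cis (2 * pi * ((k j + real n) * of_int (- 1) / of_nat (q j))) =
        1 / cis (2 * pi * ((k j + real n) / of_nat (q j)))"
      unfolding inverse_eq_divide[symmetric] cis_inverse
      by (simp only: of_int_minus of_int_1 mult_1_right minus_divide_left[symmetric] mult_minus_right)
    show ?thesis
      unfolding c plus minus bloch_wave_shift[OF x j] inv
      by (simp only: of_int_1 mult_1_right distrib_right)
  qed
  then show ?thesis
    unfolding laplacian_eq[OF x] symbol_def sum_distrib_right
    by (intro sum.cong refl) (simp only: lessThan_iff)
qed

locale coprime_periods =
  fixes d :: nat and q :: "nat \<Rightarrow> nat"
  assumes q_pos: "j < d \<Longrightarrow> q j > 0"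
    and q_coprime: "i < d \<Longrightarrow> j < d \<Longrightarrow> i \<noteq> j \<Longrightarrow> coprime (q i) (q j)"
begin

abbreviation Q :: nat where "Q \<equiv> \<Prod>j<d. q j"
abbreviation W :: "int vec set" where "W \<equiv> fundamental_domain d q"

lemma Q_pos: "Q > 0"
  using q_pos by (simp add: prod_pos)

lemma floquet_bloch_wave: "floquet d q k (bloch_wave d q k n)"
  unfolding floquet_def
proof (intro ballI allI impI)
  fix x :: "int vec" and j assume x: "x \<in> carrier_vec d" and j: "j < d"
  have "cis (2 * pi * ((k j + real n) * of_int (int (q j)) / of_nat (q j))) = cis (2 * pi * k j)"
    using q_pos[OF j] by (simp add: cis_turn_add_Ints)
  also have "\<dots> = exp (2 * pi * \<i> * k j)" by (simp add: cis_conv_exp mult_ac)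
  finally show "bloch_wave d q k n (x + int (q j) \<cdot>\<^sub>v unit_vec d j) =
      exp (2 * pi * \<i> * k j) * bloch_wave d q k n x"
    unfolding bloch_wave_shift[OF x j] by simp
qed

lemma finite_W: "finite W"
  by (metis List.finite_set set_domain_list)

lemma Q_phase: "real Q * phase d q x = of_int (\<Sum>j<d. x $ j * int (\<Prod>i\<in>{..<d} - {j}. q i))"
proof -
  have "real Q * (of_int (x $ j) / of_nat (q j)) = of_int (x $ j * int (\<Prod>i\<in>{..<d} - {j}. q i))"
    if "j < d" for j
    using q_pos[OF that] that by (subst prod.remove[of _ j]) auto
  then show ?thesis unfolding phase_def sum_distrib_left of_int_sum by (intro sum.cong) auto
qed

text \<open>Multiply the phase difference by \<open>Q\<close> and reduce modulo \<open>q\<^sub>i\<close>: only the \<open>i\<close>-th term remains, and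
  its factor \<open>Q / q\<^sub>i\<close> is invertible by coprimality. This is the injectivity part of the Chinese
  remainder theorem, and the reason why one integer suffices as a frequency.\<close>

lemma phase_diff_Ints_imp_eq:
  assumes x: "x \<in> W" and y: "y \<in> W" and int: "phase d q x - phase d q y \<in> \<int>"
  shows "x = y"
proof (rule eq_vecI)
  fix i assume "i < dim_vec y"
  then have i: "i < d" using y by (auto simp: fundamental_domain_def)
  define R where "R j = int (\<Prod>i\<in>{..<d} - {j}. q i)" for j
  obtain m where m: "phase d q x - phase d q y = of_int m" using int by (auto elim: Ints_cases)
  have "real_of_int ((\<Sum>j<d. x $ j * R j) - (\<Sum>j<d. y $ j * R j)) =
      real Q * phase d q x - real Q * phase d q y"
    unfolding of_int_diff R_def Q_phase ..
  also have "\<dots> = real_of_int (int Q * m)"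
    by (simp only: right_diff_distrib[symmetric] m of_int_mult of_int_of_nat_eq)
  finally have eq: "(\<Sum>j<d. (x $ j - y $ j) * R j) = int Q * m"
    unfolding of_int_eq_iff by (simp add: sum_subtractf left_diff_distrib)
  have "int (q i) dvd (\<Sum>j\<in>{..<d} - {i}. (x $ j - y $ j) * R j)"
    using i unfolding R_def by (intro dvd_sum dvd_mult) (auto simp: dvd_prodI)
  moreover have "int (q i) dvd (\<Sum>j<d. (x $ j - y $ j) * R j)"
  proof -
    have "q i dvd Q" using i by (intro dvd_prodI) auto
    then have "int (q i) dvd int Q" by (simp only: int_dvd_int_iff)
    then show ?thesis unfolding eq by (rule dvd_mult2)
  qed
  ultimately have "int (q i) dvd (x $ i - y $ i) * R i"
    using i by (simp add: sum.remove[of "{..<d}" i] dvd_add_left_iff)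
  moreover have "coprime (int (q i)) (R i)"
  proof -
    have "coprime (int (q i)) (int (q l))" if "l \<in> {..<d} - {i}" for l
      using q_coprime[OF i, of l] that by auto
    then show ?thesis unfolding R_def of_nat_prod by (rule prod_coprime_right)
  qed
  ultimately have "int (q i) dvd x $ i - y $ i" by (simp add: coprime_dvd_mult_left_iff)
  then have "x $ i mod int (q i) = y $ i mod int (q i)" by (simp add: mod_eq_dvd_iff)
  then show "x $ i = y $ i" using x y i by (simp add: fundamental_domain_def)
qed (use x y in \<open>auto simp: fundamental_domain_def\<close>)

text \<open>A geometric sum whose ratio is a \<open>Q\<close>-th root of unity; the ratio is \<open>1\<close> only if the two
  points coincide.\<close>

lemma character_orthogonality:
  assumes "x \<in> W" "y \<in> W"
  shows "(\<Sum>n<Q. cis (2 * pi * (real n * (phase d q x - phase d q y)))) =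
    (if x = y then of_nat Q else 0)"
proof (cases "x = y")
  case False
  define \<theta> where "\<theta> = phase d q x - phase d q y"
  have ne: "cis (2 * pi * \<theta>) \<noteq> 1"
    using phase_diff_Ints_imp_eq[OF assms] False by (auto simp: \<theta>_def cis_eq_1_iff_Ints)
  have "real Q * \<theta> \<in> \<int>" unfolding \<theta>_def right_diff_distrib Q_phase by (intro Ints_diff Ints_of_int)
  then have "cis (2 * pi * (real Q * \<theta>)) = 1" by (rule cis_multiple_2pi)
  then have one: "cis (2 * pi * \<theta>) ^ Q = 1" unfolding DeMoivre by (simp only: mult.left_commute)
  have "(\<Sum>n<Q. cis (2 * pi * (real n * \<theta>))) = (\<Sum>n<Q. cis (2 * pi * \<theta>) ^ n)"
    unfolding DeMoivre by (simp only: mult.left_commute)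
  also have "\<dots> = 0" unfolding geometric_sum[OF ne] one by simp
  finally show ?thesis using False by (simp add: \<theta>_def)
qed simp

text \<open>Read as a statement about Bloch waves, this says that multiplication by \<open>V\<close> acts as convolution with its
  Fourier coefficients. The shift \<open>b\<close> is kept on the side of the coefficients, so that no frequency
  has to be reduced modulo \<open>Q\<close>.\<close>

lemma shifted_fourier_inversion:
  assumes x: "x \<in> W"
  shows "(\<Sum>n<Q. fourier_coeff d q V (int n - b) * cis (2 * pi * (real n * phase d q x))) =
    V x * cis (2 * pi * (of_int b * phase d q x))"
proof -
  have "(\<Sum>n<Q. fourier_coeff d q V (int n - b) * cis (2 * pi * (real n * phase d q x))) =
      (\<Sum>n<Q. \<Sum>y\<in>W. V y * cis (2 * pi * (of_int b * phase d q y)) / of_nat Q *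
        cis (2 * pi * (real n * (phase d q x - phase d q y))))"
  proof (intro sum.cong refl)
    fix n
    have "cis (- (2 * pi * (of_int (int n - b) * phase d q y))) * cis (2 * pi * (real n * phase d q x)) =
        cis (2 * pi * (of_int b * phase d q y)) * cis (2 * pi * (real n * (phase d q x - phase d q y)))" for y
      unfolding cis_mult by (rule arg_cong[of _ _ cis]) (simp add: algebra_simps)
    then show "fourier_coeff d q V (int n - b) * cis (2 * pi * (real n * phase d q x)) =
      (\<Sum>y\<in>W. V y * cis (2 * pi * (of_int b * phase d q y)) / of_nat Q *
        cis (2 * pi * (real n * (phase d q x - phase d q y))))"
      unfolding fourier_coeff_def sum_divide_distrib sum_distrib_right
      by (intro sum.cong refl) (simp add: mult.assoc)
  qed
  also have "\<dots> = (\<Sum>y\<in>W. V y * cis (2 * pi * (of_int b * phase d q y)) / of_nat Q *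
      (\<Sum>n<Q. cis (2 * pi * (real n * (phase d q x - phase d q y)))))"
    unfolding sum_distrib_left by (rule sum.swap)
  also have "\<dots> = (\<Sum>y\<in>W. if y = x then V x * cis (2 * pi * (of_int b * phase d q x)) else 0)"
    using Q_pos by (intro sum.cong refl) (auto simp: character_orthogonality x simp del: of_nat_prod)
  also have "\<dots> = V x * cis (2 * pi * (of_int b * phase d q x))"
    using x finite_W by simp
  finally show ?thesis .
qed

lemma bloch_wave_eq:
  "bloch_wave d q k n x =
    cis (2 * pi * (\<Sum>j<d. k j * of_int (x $ j) / of_nat (q j))) * cis (2 * pi * (real n * phase d q x))"
  unfolding bloch_wave_def phase_def cis_mult
  by (rule arg_cong[of _ _ cis])
    (simp add: ring_distribs add_divide_distrib sum.distrib sum_distrib_left)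

text \<open>The Bloch waves with quasimomentum \<open>k\<close> form a basis of the Floquet space. In it the Laplacian
  is diagonal and multiplication by \<open>V\<close> is a convolution, so the two matrices are similar.\<close>

lemma floquet_det_eq:
  "floquet_det d q V k lam = det (fourier_matrix d q V (\<lambda>j. cis (2 * pi * (k j / q j))) lam)"
proof -
  let ?z = "\<lambda>j. cis (2 * pi * (k j / q j))"
  let ?e = "bloch_wave d q k"
  let ?w = "\<lambda>a. domain_list d q ! a"
  let ?F = "floquet_matrix d q V k" and ?G = "fourier_matrix d q V ?z lam"
  \<comment> \<open>the change of basis, a multiple of a unitary matrix with inverse proportional to \<open>E'\<close>\<close>
  define E where "E = mat Q Q (\<lambda>(a, n). ?e n (?w a))"
  define E' where "E' = mat Q Q (\<lambda>(n, b). cnj (?e n (?w b)))"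
  have wW: "?w a \<in> W" if "a < Q" for a
    using that by (metis length_domain_list nth_mem set_domain_list)
  have F: "?F \<in> carrier_mat Q Q" by (simp add: floquet_matrix_def Let_def)
  have G: "?G \<in> carrier_mat Q Q" by (simp add: fourier_matrix_def)
  have E: "E \<in> carrier_mat Q Q" and E': "E' \<in> carrier_mat Q Q" by (auto simp: E_def E'_def)
  have FE: "(?F - lam \<cdot>\<^sub>m 1\<^sub>m Q) * E = E * ?G"
  proof (rule eq_matI)
    fix a b assume "a < dim_row (E * ?G)" "b < dim_col (E * ?G)"
    then have a: "a < Q" and b: "b < Q" using E G by auto
    let ?x = "?w a"
    have x: "?x \<in> carrier_vec d" using wW[OF a] by (simp add: fundamental_domain_def)
    have colE: "col E b = vec Q (\<lambda>c. ?e b (?w c))" using b by (auto simp: E_def)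
    have "(?F * E) $$ (a, b) = (?F *\<^sub>v col E b) $ a"
      using a b F E by simp
    also have "\<dots> = schroedinger d V (?e b) ?x"
      unfolding colE using floquet_matrix_correct[OF _ floquet_bloch_wave[of k b], of V] a q_pos
      by (metis index_vec)
    finally have FE: "(?F * E) $$ (a, b) = (symbol {..<d} q ?z b + V ?x) * ?e b ?x"
      by (simp add: schroedinger_def laplacian_bloch_wave[OF x] ring_distribs)
    have "(?F - lam \<cdot>\<^sub>m 1\<^sub>m Q) * E = ?F * E - lam \<cdot>\<^sub>m E"
      using F E by (simp add: minus_mult_distrib_mat[of _ Q Q] mult_smult_assoc_mat[of _ Q Q])
    then have lhs: "((?F - lam \<cdot>\<^sub>m 1\<^sub>m Q) * E) $$ (a, b) = (symbol {..<d} q ?z b + V ?x - lam) * ?e b ?x"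
      using a b F E by (simp add: FE left_diff_distrib) (simp add: E_def)
    let ?c = "cis (2 * pi * (\<Sum>j<d. k j * of_int (?x $ j) / of_nat (q j)))"
    have "(\<Sum>n<Q. ?e n ?x * fourier_coeff d q V (int n - int b)) =
        ?c * (\<Sum>n<Q. fourier_coeff d q V (int n - int b) * cis (2 * pi * (real n * phase d q ?x)))"
      unfolding bloch_wave_eq sum_distrib_left by (intro sum.cong refl) (simp only: mult_ac)
    also have "\<dots> = V ?x * ?e b ?x"
      unfolding shifted_fourier_inversion[OF wW[OF a]] by (simp add: bloch_wave_eq mult_ac)
    finally have conv: "(\<Sum>n<Q. ?e n ?x * fourier_coeff d q V (int n - int b)) = V ?x * ?e b ?x" .
    have "(E * ?G) $$ (a, b) = (\<Sum>n<Q. ?e n ?x * fourier_coeff d q V (int n - int b) +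
        (if n = b then ?e b ?x * (symbol {..<d} q ?z b - lam) else 0))"
      using a b by (simp add: E_def fourier_matrix_def scalar_prod_def atLeast0LessThan)
        (auto intro!: sum.cong simp: ring_distribs)
    also have "\<dots> = (symbol {..<d} q ?z b + V ?x - lam) * ?e b ?x"
      using b by (simp add: sum.distrib conv) (simp add: algebra_simps)
    finally show "((?F - lam \<cdot>\<^sub>m 1\<^sub>m Q) * E) $$ (a, b) = (E * ?G) $$ (a, b)" using lhs by simp
  qed (use F E G in auto)
  have "E * E' = of_nat Q \<cdot>\<^sub>m 1\<^sub>m Q"
  proof (rule eq_matI)
    fix a b assume "a < dim_row (of_nat Q \<cdot>\<^sub>m 1\<^sub>m Q :: complex mat)" "b < dim_col (of_nat Q \<cdot>\<^sub>m 1\<^sub>m Q :: complex mat)"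
    then have a: "a < Q" and b: "b < Q" by auto
    let ?c = "\<lambda>x. cis (2 * pi * (\<Sum>j<d. k j * of_int (x $ j) / of_nat (q j)))"
    have "?e n x * cnj (?e n y) =
        ?c x * cnj (?c y) * cis (2 * pi * (real n * (phase d q x - phase d q y)))" for n x y
      unfolding bloch_wave_eq complex_cnj_mult by (simp add: cis_cnj cis_mult algebra_simps)
    then have "(E * E') $$ (a, b) = ?c (?w a) * cnj (?c (?w b)) *
        (\<Sum>n<Q. cis (2 * pi * (real n * (phase d q (?w a) - phase d q (?w b)))))"
      using a b by (simp add: E_def E'_def scalar_prod_def atLeast0LessThan sum_distrib_left)
    also have "\<dots> = (if a = b then of_nat Q else 0)"
      unfolding character_orthogonality[OF wW[OF a] wW[OF b]]
      using a b distinct_domain_list[of d q] length_domain_list[of d q]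
      by (auto simp: nth_eq_iff_index_eq cis_cnj cis_mult)
    finally show "(E * E') $$ (a, b) = (of_nat Q \<cdot>\<^sub>m 1\<^sub>m Q) $$ (a, b)" using a b by simp
  qed (auto simp: E_def E'_def)
  then have "det E * det E' = of_nat Q ^ Q"
    using det_mult[OF E E'] by (simp del: of_nat_prod)
  moreover have "(of_nat Q :: complex) ^ Q \<noteq> 0"
    by (metis Q_pos of_nat_eq_0_iff power_eq_0_iff less_irrefl)
  ultimately have nz: "det E \<noteq> 0" by (metis mult_zero_left)
  have FL: "?F - lam \<cdot>\<^sub>m 1\<^sub>m Q \<in> carrier_mat Q Q" by auto
  have "det (?F - lam \<cdot>\<^sub>m 1\<^sub>m Q) * det E = det E * det ?G"
    using FE det_mult[OF FL E] det_mult[OF E G] by metis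
  then show ?thesis using nz by (simp add: floquet_det_def)
qed

lemma fourier_coeff_minus:
  assumes "\<forall>x\<in>carrier_vec d. V x \<in> \<real>"
  shows "fourier_coeff d q V (- a) = cnj (fourier_coeff d q V a)"
proof -
  have "V x * cis (- (2 * pi * (of_int (- a) * phase d q x))) =
      cnj (V x * cis (- (2 * pi * (of_int a * phase d q x))))" if "x \<in> W" for x
  proof -
    have "cnj (V x) = V x" using assms that by (auto simp: fundamental_domain_def Reals_cnj_iff)
    then show ?thesis by (simp add: cis_cnj)
  qed
  then show ?thesis unfolding fourier_coeff_def by (simp add: cnj_sum)
qed

end

section \<open>From the torus to complex quasimomenta\<close>

lemma laurent_det_fourier_matrix:
  "laurent (\<lambda>\<alpha>. det (fourier_matrix d q V (z(i := \<alpha>)) lam))"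
proof -
  have "laurent (\<lambda>\<alpha>. cis (2 * pi * (real n / q j)) * (z(i := \<alpha>)) j +
      1 / (cis (2 * pi * (real n / q j)) * (z(i := \<alpha>)) j))" for n j
  proof (cases "j = i")
    case True
    have "laurent (\<lambda>\<alpha>. cis (2 * pi * (real n / q j)) * \<alpha> + 1 / cis (2 * pi * (real n / q j)) * (1 / \<alpha>))"
      by (intro laurent_add laurent_mult laurent_const laurent_ident laurent_inverse)
    then show ?thesis using True by simp
  next
    case False
    then show ?thesis by (simp add: laurent_const)
  qed
  then have "laurent (\<lambda>\<alpha>. symbol {..<d} q (z(i := \<alpha>)) n)" for n
    unfolding symbol_def by (intro laurent_sum)
  then have "laurent (\<lambda>\<alpha>. symbol {..<d} q (z(i := \<alpha>)) n - lam)" for n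
    using laurent_add[OF _ laurent_const[of "- lam"]] by simp
  then have "laurent (\<lambda>\<alpha>. fourier_coeff d q V (int m - int n) +
      (if m = n then symbol {..<d} q (z(i := \<alpha>)) m - lam else 0))" for m n
    by (cases "m = n") (auto intro!: laurent_add laurent_const)
  then show ?thesis unfolding fourier_matrix_def by (intro laurent_det) simp
qed

lemma det_fourier_matrix_eq_off_unit_circle:
  assumes "\<And>\<alpha>. cmod \<alpha> = 1 \<Longrightarrow>
      det (fourier_matrix d q V (z(i := \<alpha>)) z1) = det (fourier_matrix d q Y (z(i := \<alpha>)) z2)"
    and "\<alpha> \<noteq> 0"
  shows "det (fourier_matrix d q V (z(i := \<alpha>)) z1) = det (fourier_matrix d q Y (z(i := \<alpha>)) z2)"
  by (rule laurent_eq_if_eq_on_unit_circle[OF laurent_det_fourier_matrix laurent_det_fourier_matrix])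
    (use assms in auto)

context coprime_periods begin

text \<open>Isospectrality gives equality for unimodular values. The determinants are Laurent polynomials
  in each variable separately, so the three variables can be released from the unit circle one after
  the other.\<close>

lemma isospectral_imp_det_eq:
  assumes iso: "partially_fermi_isospectral d q S z1 z2 V Y"
    and S: "s \<in> S" "t \<in> S" "u \<in> S" "S \<subseteq> {..<d}" and distinct: "s \<noteq> t" "s \<noteq> u" "t \<noteq> u"
  obtains z where "\<And>\<alpha> \<beta> \<gamma>. \<alpha> \<noteq> 0 \<Longrightarrow> \<beta> \<noteq> 0 \<Longrightarrow> \<gamma> \<noteq> 0 \<Longrightarrow>
    det (fourier_matrix d q V (z(s := \<alpha>, t := \<beta>, u := \<gamma>)) z1) =
    det (fourier_matrix d q Y (z(s := \<alpha>, t := \<beta>, u := \<gamma>)) z2)"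
proof -
  let ?det = "\<lambda>V z lam. det (fourier_matrix d q V z lam)"
  obtain k0 where k0: "\<And>k. floquet_det d q V (\<lambda>j. if j \<in> S then k j else k0 j) z1 =
      floquet_det d q Y (\<lambda>j. if j \<in> S then k j else k0 j) z2"
    using iso unfolding partially_fermi_isospectral_def by blast
  define z where "z j = cis (2 * pi * (k0 j / q j))" for j
  have q: "q s > 0" "q t > 0" "q u > 0" using S by (auto intro: q_pos)
  have circle: "?det V (z(s := \<alpha>, t := \<beta>, u := \<gamma>)) z1 = ?det Y (z(s := \<alpha>, t := \<beta>, u := \<gamma>)) z2"
    if unit: "cmod \<alpha> = 1" "cmod \<beta> = 1" "cmod \<gamma> = 1" for \<alpha> \<beta> \<gamma>
  proof -
    define k where "k = k0(s := q s * Arg \<alpha> / (2 * pi), t := q t * Arg \<beta> / (2 * pi), u := q u * Arg \<gamma> / (2 * pi))"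
    have arg: "cis (Arg \<zeta>) = \<zeta>" if "cmod \<zeta> = 1" for \<zeta>
      using that rcis_cmod_Arg[of \<zeta>] by (simp add: rcis_def)
    have "(\<lambda>j. cis (2 * pi * ((if j \<in> S then k j else k0 j) / q j))) = z(s := \<alpha>, t := \<beta>, u := \<gamma>)"
      using S q unit by (intro ext) (auto simp: k_def z_def arg)
    then show ?thesis using k0[of k] by (simp only: floquet_det_eq)
  qed
  have "?det V (z(s := \<alpha>, t := \<beta>, u := \<gamma>)) z1 = ?det Y (z(s := \<alpha>, t := \<beta>, u := \<gamma>)) z2"
    if "\<alpha> \<noteq> 0" "\<beta> \<noteq> 0" "\<gamma> \<noteq> 0" for \<alpha> \<beta> \<gamma>
  proof -
    have 1: "?det V (z(s := \<alpha>, t := \<beta>, u := \<gamma>)) z1 = ?det Y (z(s := \<alpha>, t := \<beta>, u := \<gamma>)) z2"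
      if "cmod \<alpha> = 1" "cmod \<beta> = 1" "\<gamma> \<noteq> 0" for \<alpha> \<beta> \<gamma>
      by (rule det_fourier_matrix_eq_off_unit_circle) (use circle that in auto)
    have 2: "?det V (z(s := \<alpha>, t := \<beta>, u := \<gamma>)) z1 = ?det Y (z(s := \<alpha>, t := \<beta>, u := \<gamma>)) z2"
      if "cmod \<alpha> = 1" "\<beta> \<noteq> 0" "\<gamma> \<noteq> 0" for \<alpha> \<beta> \<gamma>
      unfolding fun_upd_twist[OF distinct(3)]
      by (rule det_fourier_matrix_eq_off_unit_circle)
        (use 1 that in \<open>auto simp: fun_upd_twist[OF distinct(3)]\<close>)
    have twist: "z(s := \<alpha>, t := \<beta>, u := \<gamma>) = z(t := \<beta>, u := \<gamma>, s := \<alpha>)" for \<alpha> \<beta> \<gamma>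
      using distinct by (auto simp: fun_eq_iff)
    show ?thesis unfolding twist
      by (rule det_fourier_matrix_eq_off_unit_circle) (use 2 that in \<open>auto simp flip: twist\<close>)
  qed
  then show ?thesis by (rule that)
qed

end

section \<open>Roots of unity\<close>

text \<open>The hypothesis says that the determinant with rows \<open>(1, 1, 1)\<close>, \<open>(w\<^sub>1, w\<^sub>2, w\<^sub>3)\<close>,
  \<open>(u\<^sub>1, u\<^sub>2, u\<^sub>3)\<close> vanishes, and the conclusion that \<open>u\<close> is proportional to one of the other two rows.
  On the unit circle complex conjugation is inversion, so that conjugating the equation yields a
  second one; the two together factor.\<close>

lemma unit_circle_determinant:
  fixes u\<^sub>1 u\<^sub>2 u\<^sub>3 w\<^sub>1 w\<^sub>2 w\<^sub>3 :: complex
  assumes unit: "cmod u\<^sub>1 = 1" "cmod u\<^sub>2 = 1" "cmod u\<^sub>3 = 1" "cmod w\<^sub>1 = 1" "cmod w\<^sub>2 = 1" "cmod w\<^sub>3 = 1"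
    and distinct: "w\<^sub>1 \<noteq> w\<^sub>2" "w\<^sub>1 \<noteq> w\<^sub>3" "w\<^sub>2 \<noteq> w\<^sub>3"
    and det: "u\<^sub>1 * (w\<^sub>3 - w\<^sub>2) + u\<^sub>2 * (w\<^sub>1 - w\<^sub>3) + u\<^sub>3 * (w\<^sub>2 - w\<^sub>1) = 0"
  shows "u\<^sub>1 = u\<^sub>2 \<and> u\<^sub>2 = u\<^sub>3 \<or> u\<^sub>1 / w\<^sub>1 = u\<^sub>2 / w\<^sub>2 \<and> u\<^sub>2 / w\<^sub>2 = u\<^sub>3 / w\<^sub>3"
proof -
  define D where "D = u\<^sub>1 * (w\<^sub>3 - w\<^sub>2) + u\<^sub>2 * (w\<^sub>1 - w\<^sub>3) + u\<^sub>3 * (w\<^sub>2 - w\<^sub>1)"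
  define D' where "D' = u\<^sub>2 * u\<^sub>3 * w\<^sub>1 * (w\<^sub>2 - w\<^sub>3) + u\<^sub>1 * u\<^sub>3 * w\<^sub>2 * (w\<^sub>3 - w\<^sub>1) + u\<^sub>1 * u\<^sub>2 * w\<^sub>3 * (w\<^sub>1 - w\<^sub>2)"
  have D: "D = 0" using det by (simp add: D_def)
  have inv: "cnj z = 1 / z" if "cmod z = 1" for z
    using that complex_norm_square[of z] by (intro eq_divide_imp) (auto simp: mult.commute)
  have nz: "u\<^sub>1 \<noteq> 0" "u\<^sub>2 \<noteq> 0" "u\<^sub>3 \<noteq> 0" "w\<^sub>1 \<noteq> 0" "w\<^sub>2 \<noteq> 0" "w\<^sub>3 \<noteq> 0" using unit by auto
  have "D' = u\<^sub>1 * u\<^sub>2 * u\<^sub>3 * w\<^sub>1 * w\<^sub>2 * w\<^sub>3 * cnj D"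
    unfolding D_def D'_def by (simp add: inv unit) (use nz in \<open>simp add: field_simps\<close>)
  then have D': "D' = 0" using D by simp
  have "(u\<^sub>1 - u\<^sub>3) * (w\<^sub>3 - w\<^sub>2) * (u\<^sub>2 * w\<^sub>1 - u\<^sub>1 * w\<^sub>2) = D' - D * (u\<^sub>1 * w\<^sub>2)"
    unfolding D_def D'_def by (simp add: algebra_simps)
  then have "(u\<^sub>1 - u\<^sub>3) * (w\<^sub>3 - w\<^sub>2) * (u\<^sub>2 * w\<^sub>1 - u\<^sub>1 * w\<^sub>2) = 0" using D D' by simp
  then consider "u\<^sub>1 = u\<^sub>3" | "u\<^sub>2 * w\<^sub>1 = u\<^sub>1 * w\<^sub>2" using distinct by auto
  then show ?thesis
  proof cases
    case 1
    then have "(u\<^sub>2 - u\<^sub>3) * (w\<^sub>1 - w\<^sub>3) = D" by (simp add: D_def algebra_simps)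
    then have "(u\<^sub>2 - u\<^sub>3) * (w\<^sub>1 - w\<^sub>3) = 0" using D by simp
    then show ?thesis using 1 distinct by simp
  next
    case 2
    have "(w\<^sub>2 - w\<^sub>1) * (u\<^sub>3 * w\<^sub>2 - u\<^sub>2 * w\<^sub>3) = w\<^sub>2 * D + (u\<^sub>2 * w\<^sub>1 - u\<^sub>1 * w\<^sub>2) * (w\<^sub>3 - w\<^sub>2)"
      unfolding D_def by (simp add: algebra_simps)
    then have "(w\<^sub>2 - w\<^sub>1) * (u\<^sub>3 * w\<^sub>2 - u\<^sub>2 * w\<^sub>3) = 0" using D 2 by simp
    then have "u\<^sub>3 * w\<^sub>2 = u\<^sub>2 * w\<^sub>3" using distinct by simp
    then show ?thesis using 2 nz by (simp add: field_simps)
  qed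
qed

lemma cis_turn_eq_iff: "cis (2 * pi * a) = cis (2 * pi * b) \<longleftrightarrow> a - b \<in> \<int>"
proof -
  have "cis (2 * pi * a) = cis (2 * pi * b) \<longleftrightarrow> cis (2 * pi * (a - b)) = 1"
    by (simp add: right_diff_distrib flip: cis_divide)
  then show ?thesis by (simp add: cis_eq_1_iff_Ints)
qed

lemma fraction_Ints_iff:
  assumes "p > 0" shows "of_int a / real p \<in> \<int> \<longleftrightarrow> int p dvd a"
proof
  assume "of_int a / real p \<in> \<int>"
  then obtain m where "of_int a / real p = of_int m" by (auto elim: Ints_cases)
  then have "real_of_int a = real_of_int (int p * m)" using assms by (simp add: field_simps)
  then show "int p dvd a" unfolding of_int_eq_iff by simp
next
  assume "int p dvd a"
  then show "of_int a / real p \<in> \<int>" using assms by (auto simp: dvd_def)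
qed

text \<open>A root of unity whose order divides two coprime numbers is \<open>1\<close>.\<close>

lemma roots_of_unity_coprime_eq:
  assumes "p > 0" "r > 0" "coprime p r"
    and eq: "cis (2 * pi * (of_int a / real p)) = cis (2 * pi * (of_int b / real r))"
  shows "int p dvd a \<and> int r dvd b"
proof -
  obtain m where "of_int a / real p - of_int b / real r = of_int m"
    using eq[unfolded cis_turn_eq_iff] by (rule Ints_cases)
  then have "real_of_int (a * int r - b * int p) = real_of_int (m * int p * int r)"
    using assms by (simp add: field_simps)
  then have eq: "a * int r = int p * (b + m * int r)" "b * int p = int r * (a - m * int p)"
    unfolding of_int_eq_iff by (simp_all add: algebra_simps)
  have "int p dvd a * int r" "int r dvd b * int p" unfolding eq by simp_all
  then show ?thesis
    using assms(3) by (simp add: coprime_dvd_mult_left_iff coprime_commute)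
qed

lemma affine_inverse_tendsto_0:
  fixes a b c :: complex
  assumes "a \<noteq> 0" "c \<noteq> 0"
  shows "((\<lambda>x. 1 / (c * (of_real x * a + b))) \<longlongrightarrow> 0) at_top"
    and "\<forall>\<^sub>F x in at_top. of_real x * a + b \<noteq> 0"
proof -
  have "filterlim (\<lambda>x. a * complex_of_real x) at_infinity at_top"
    by (rule tendsto_mult_filterlim_at_infinity[OF tendsto_const \<open>a \<noteq> 0\<close> filterlim_of_real_at_infinity])
  then have lim: "filterlim (\<lambda>x. b + of_real x * a) at_infinity at_top"
    by (intro tendsto_add_filterlim_at_infinity[OF tendsto_const]) (simp add: mult.commute)
  then show "\<forall>\<^sub>F x in at_top. of_real x * a + b \<noteq> 0"
    using filterlim_at_infinity_imp_eventually_ne[OF lim, of 0] by (simp add: add.commute)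
  show "((\<lambda>x. 1 / (c * (of_real x * a + b))) \<longlongrightarrow> 0) at_top"
    using tendsto_divide_0[OF tendsto_const, OF tendsto_mult_filterlim_at_infinity[OF tendsto_const \<open>c \<noteq> 0\<close> lim], of 1]
    by (simp add: add.commute)
qed

section \<open>Comparison of squared Fourier coefficients\<close>

context coprime_periods begin

text \<open>\<open>I\<close> and \<open>J\<close> collect the frequencies whose components in the directions \<open>s\<close>, \<open>t\<close>, \<open>u\<close> are those of
  \<open>0\<close> and of \<open>l\<close>. Along a suitable line exactly the diagonal entries in these rows stay bounded,
  and their limits are adjustable, so that the limits of the determinants determine the sum
  of the products.\<close>

lemma fourier_products_eq:
  assumes lt: "s < d" "t < d" "u < d" and distinct: "s \<noteq> t" "s \<noteq> u" "t \<noteq> u"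
    and l: "l < Q" "\<not> q s dvd l" "\<not> q t dvd l"
    and dets: "\<And>\<alpha> \<beta> \<gamma>. \<alpha> \<noteq> 0 \<Longrightarrow> \<beta> \<noteq> 0 \<Longrightarrow> \<gamma> \<noteq> 0 \<Longrightarrow>
      det (fourier_matrix d q V (z(s := \<alpha>, t := \<beta>, u := \<gamma>)) z1) =
      det (fourier_matrix d q Y (z(s := \<alpha>, t := \<beta>, u := \<gamma>)) z2)"
  defines "I \<equiv> {n. n < Q \<and> (\<forall>i\<in>{s, t, u}. int (q i) dvd int n)}"
    and "J \<equiv> {n. n < Q \<and> (\<forall>i\<in>{s, t, u}. int (q i) dvd int n - int l)}"
  shows "(\<Sum>i\<in>I. \<Sum>j\<in>J. fourier_coeff d q V (int i - int j) * fourier_coeff d q V (int j - int i)) =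
    (\<Sum>i\<in>I. \<Sum>j\<in>J. fourier_coeff d q Y (int i - int j) * fourier_coeff d q Y (int j - int i))"
proof -
  have q: "q s > 0" "q t > 0" "q u > 0" using lt by (auto intro: q_pos)
  define \<chi> where "\<chi> n i = cis (2 * pi * (real n / q i))" for n i
  have \<chi>_dvd: "int (q i) dvd int m \<and> int (q j) dvd int n"
    if "\<chi> m i = \<chi> n j" "i < d" "j < d" "i \<noteq> j" for m n i j
    using roots_of_unity_coprime_eq[of "q i" "q j" "int m" "int n"] that q_pos q_coprime
    by (auto simp: \<chi>_def)
  have \<chi>_quot: "\<chi> m i / \<chi> n i = cis (2 * pi * (of_int (int m - int n) / q i))" for m n i
    by (simp add: \<chi>_def cis_divide right_diff_distrib diff_divide_distrib)
  have quot_dvd: "int (q i) dvd int m - int n \<and> int (q j) dvd int m - int n"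
    if "\<chi> m i / \<chi> n i = \<chi> m j / \<chi> n j" "i < d" "j < d" "i \<noteq> j" for m n i j
    using roots_of_unity_coprime_eq[of "q i" "q j" "int m - int n" "int m - int n"] that q_pos q_coprime
    by (auto simp: \<chi>_quot)
  have \<chi>_unit: "cmod (\<chi> n i) = 1" and \<chi>_nz: "\<chi> n i \<noteq> 0" for n i by (simp_all add: \<chi>_def)
  let ?w = "\<chi> l"
  have w: "?w s \<noteq> ?w t" "?w s \<noteq> ?w u" "?w t \<noteq> ?w u"
    using \<chi>_dvd[of l s l t] \<chi>_dvd[of l s l u] \<chi>_dvd[of l t l u] lt distinct l by auto
  \<comment> \<open>the cross product of \<open>(1, 1, 1)\<close> and \<open>(w\<^sub>s, w\<^sub>t, w\<^sub>u)\<close>; then \<open>L n\<close> is the determinant of these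
    two triples and that of \<open>n\<close>\<close>
  define a where "a = (\<lambda>i. if i = s then ?w u - ?w t else if i = t then ?w s - ?w u else ?w t - ?w s)"
  define L where "L n = \<chi> n s * a s + \<chi> n t * a t + \<chi> n u * a u" for n
  have a: "a s \<noteq> 0" "a t \<noteq> 0" "a u \<noteq> 0" using w distinct by (auto simp: a_def)
  have \<chi>_I: "\<chi> n i = 1" if "n \<in> I" "i \<in> {s, t, u}" for n i
    using that q fraction_Ints_iff[of "q i" "int n"]
    unfolding \<chi>_def cis_eq_1_iff_Ints by (auto simp: I_def)
  have \<chi>_J: "\<chi> n i = ?w i" if "n \<in> J" "i \<in> {s, t, u}" for n i
  proof -
    have "\<chi> n i / ?w i = 1"
      using that q fraction_Ints_iff[of "q i" "int n - int l"]
      unfolding \<chi>_quot cis_eq_1_iff_Ints by (auto simp: J_def)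
    then show ?thesis using \<chi>_nz by simp
  qed
  have L_I: "L n = 0" if "n \<in> I" for n
    using \<chi>_I[OF that] distinct by (simp add: L_def a_def)
  have L_J: "L n = 0" if "n \<in> J" for n
    using \<chi>_J[OF that] distinct by (simp add: L_def a_def algebra_simps)
  have L_nz: "L n \<noteq> 0" if "n \<in> {..<Q} - (I \<union> J)" for n
  proof
    assume "L n = 0"
    then have "\<chi> n s * (?w u - ?w t) + \<chi> n t * (?w s - ?w u) + \<chi> n u * (?w t - ?w s) = 0"
      using distinct by (simp add: L_def a_def)
    from unit_circle_determinant[OF \<chi>_unit \<chi>_unit \<chi>_unit \<chi>_unit \<chi>_unit \<chi>_unit w this]
    show False
    proof (elim disjE conjE)
      assume "\<chi> n s = \<chi> n t" "\<chi> n t = \<chi> n u"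
      then have "n \<in> I"
        using \<chi>_dvd[of n s n t] \<chi>_dvd[of n t n u] lt distinct that by (simp add: I_def)
      then show False using that by simp
    next
      assume "\<chi> n s / ?w s = \<chi> n t / ?w t" "\<chi> n t / ?w t = \<chi> n u / ?w u"
      then have "n \<in> J"
        using quot_dvd[of n s l t] quot_dvd[of n t l u] lt distinct that by (simp add: J_def)
      then show False using that by simp
    qed
  qed
  have disj: "I \<inter> J = {}"
  proof -
    have False if "n \<in> I" "n \<in> J" for n
      using that l dvd_diff[of "int (q s)" "int n" "int n - int l"] by (auto simp: I_def J_def)
    then show ?thesis by blast
  qed
  have "0 \<in> I" "l \<in> J" using l Q_pos by (auto simp: I_def J_def)
  then have ne: "I \<noteq> {}" "J \<noteq> {}" by blast+
  have sub: "I \<union> J \<subseteq> {..<Q}" by (auto simp: I_def J_def)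
  have fin: "finite I" "finite J" by (auto simp: I_def J_def)
  define M where "M V lam i j = fourier_coeff d q V (int i - int j) +
      (if i = j then symbol ({..<d} - {s, t, u}) q z i - lam else 0)" for V lam i j
  have "(\<Sum>U\<in>Pow (I \<union> J). (\<Prod>i\<in>(I \<union> J) - U. if i \<in> I then \<mu> else \<nu>) * principal_minor (M V z1) U) =
      (\<Sum>U\<in>Pow (I \<union> J). (\<Prod>i\<in>(I \<union> J) - U. if i \<in> I then \<mu> else \<nu>) * principal_minor (M Y z2) U)"
    for \<mu> \<nu>
  proof -
    \<comment> \<open>the solution of \<open>bs + bt = \<mu>\<close> and \<open>w\<^sub>s bs + w\<^sub>t bt = \<nu>\<close>: two equations, so the third
      component of the offset can be \<open>0\<close>\<close>
    define bs where "bs = (\<nu> - ?w t * \<mu>) / (?w s - ?w t)"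
    define bt where "bt = (?w s * \<mu> - \<nu>) / (?w s - ?w t)"
    define \<zeta> where "\<zeta> x = z(s := of_real x * a s + bs, t := of_real x * a t + bt, u := of_real x * a u + 0)"
      for x :: real
    define T where "T x n = symbol {s, t, u} q (\<zeta> x) n" for x n
    define c where "c n = \<chi> n s * bs + \<chi> n t * bt" for n
    define R where "R n x = 1 / (\<chi> n s * (of_real x * a s + bs)) + 1 / (\<chi> n t * (of_real x * a t + bt)) +
      1 / (\<chi> n u * (of_real x * a u + 0))" for n and x :: real
    have T: "T x n = of_real x * L n + c n + R n x" for x n
      using distinct unfolding T_def symbol_def L_def c_def R_def \<chi>_def[symmetric]
      by (simp add: \<zeta>_def algebra_simps)
    have R: "(R n \<longlongrightarrow> 0) at_top" for n
    proof -
      have "(R n \<longlongrightarrow> 0 + 0 + 0) at_top"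
        unfolding R_def by (intro tendsto_add affine_inverse_tendsto_0 a \<chi>_nz)
      then show ?thesis by simp
    qed
    have c_I: "c n = \<mu>" if "n \<in> I" for n
    proof -
      have "bs + bt = (?w s - ?w t) * \<mu> / (?w s - ?w t)"
        unfolding bs_def bt_def add_divide_distrib[symmetric] by (simp add: algebra_simps)
      then show ?thesis using \<chi>_I[OF that] w by (simp add: c_def)
    qed
    have c_J: "c n = \<nu>" if "n \<in> J" for n
    proof -
      have "?w s * bs + ?w t * bt = (?w s - ?w t) * \<nu> / (?w s - ?w t)"
        unfolding bs_def bt_def times_divide_eq_right add_divide_distrib[symmetric]
        by (simp add: algebra_simps)
      then show ?thesis using \<chi>_J[OF that] w by (simp add: c_def)
    qed
    have bounded: "((\<lambda>x. T x n) \<longlongrightarrow> (if n \<in> I then \<mu> else \<nu>)) at_top" if "n \<in> I \<union> J" for n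
    proof -
      have "L n = 0" "c n = (if n \<in> I then \<mu> else \<nu>)"
        using that L_I L_J c_I c_J by auto
      then show ?thesis unfolding T using tendsto_add[OF tendsto_const R] by fastforce
    qed
    have inv0: "((\<lambda>x. 1 / of_real x :: complex) \<longlongrightarrow> 0) at_top"
      using affine_inverse_tendsto_0(1)[of 1 1 0] by simp
    have growing: "((\<lambda>x. T x n / of_real x) \<longlongrightarrow> L n) at_top" for n
    proof -
      have "((\<lambda>x. L n + (c n + R n x) * (1 / of_real x)) \<longlongrightarrow> L n + (c n + 0) * 0) at_top"
        by (intro tendsto_intros R inv0)
      moreover have "\<forall>\<^sub>F x in at_top. L n + (c n + R n x) * (1 / of_real x) = T x n / of_real x"
        using eventually_gt_at_top[of 0]
        by eventually_elim (simp add: T field_simps)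
      ultimately show ?thesis by (simp add: tendsto_cong)
    qed
    have dets_M: "det (fourier_matrix d q V (\<zeta> x) lam) =
        det (mat Q Q (\<lambda>(i, j). M V lam i j + (if i = j then T x i else 0)))" for V lam x
    proof -
      have "symbol {..<d} q (\<zeta> x) n = symbol ({..<d} - {s, t, u}) q z n + T x n" for n
      proof -
        have "symbol {..<d} q (\<zeta> x) n = symbol ({..<d} - {s, t, u}) q (\<zeta> x) n + T x n"
          unfolding symbol_def T_def using lt by (subst sum.subset_diff[of "{s, t, u}"]) auto
        moreover have "symbol ({..<d} - {s, t, u}) q (\<zeta> x) n = symbol ({..<d} - {s, t, u}) q z n"
          unfolding symbol_def by (intro sum.cong refl) (auto simp: \<zeta>_def)
        ultimately show ?thesis by simp
      qed
      then show ?thesis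
        unfolding fourier_matrix_def M_def
        by (intro arg_cong[of _ _ det] cong_mat) auto
    qed
    have "\<forall>\<^sub>F x in at_top. det (fourier_matrix d q V (\<zeta> x) z1) = det (fourier_matrix d q Y (\<zeta> x) z2)"
      using affine_inverse_tendsto_0(2)[OF a(1) zero_neq_one[symmetric], of bs]
        affine_inverse_tendsto_0(2)[OF a(2) zero_neq_one[symmetric], of bt]
        affine_inverse_tendsto_0(2)[OF a(3) zero_neq_one[symmetric], of 0]
      unfolding \<zeta>_def by eventually_elim (rule dets)
    then have ev: "\<forall>\<^sub>F x in at_top.
        det (mat Q Q (\<lambda>(i, j). M V z1 i j + (if i = j then T x i else 0))) / (\<Prod>i\<in>{..<Q} - (I \<union> J). of_real x * L i) =
        det (mat Q Q (\<lambda>(i, j). M Y z2 i j + (if i = j then T x i else 0))) / (\<Prod>i\<in>{..<Q} - (I \<union> J). of_real x * L i)"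
      unfolding dets_M by eventually_elim simp
    have lim: "((\<lambda>x. det (mat Q Q (\<lambda>(i, j). A i j + (if i = j then T x i else 0))) /
          (\<Prod>i\<in>{..<Q} - (I \<union> J). of_real x * L i)) \<longlongrightarrow>
        (\<Sum>U\<in>Pow (I \<union> J). (\<Prod>i\<in>(I \<union> J) - U. if i \<in> I then \<mu> else \<nu>) * principal_minor A U)) at_top"
      for A
      by (rule det_add_diagonal_tendsto[OF sub bounded growing L_nz])
    show ?thesis
      by (rule tendsto_unique[OF trivial_limit_at_top_linorder _ lim])
        (rule Lim_transform_eventually[OF lim ev])
  qed
  from off_diagonal_products_determined[OF fin disj ne this]
  have "(\<Sum>i\<in>I. \<Sum>j\<in>J. M V z1 i j * M V z1 j i) = (\<Sum>i\<in>I. \<Sum>j\<in>J. M Y z2 i j * M Y z2 j i)" .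
  moreover have "(\<Sum>i\<in>I. \<Sum>j\<in>J. M V lam i j * M V lam j i) =
      (\<Sum>i\<in>I. \<Sum>j\<in>J. fourier_coeff d q V (int i - int j) * fourier_coeff d q V (int j - int i))" for V lam
    using disj by (intro sum.cong refl) (auto simp: M_def)
  ultimately show ?thesis by simp
qed

text \<open>For real \<open>Y\<close> the sum of products is a sum of squared moduli, equal to the sum for \<open>V\<close>. The latter is
  \<open>0\<close>, as every \<open>i - j\<close> in it is congruent to \<open>- l\<close> modulo \<open>q\<^sub>s\<close> and \<open>q\<^sub>t\<close>. The term with
  \<open>i = 0\<close> and \<open>j = l\<close> gives the claim.\<close>

lemma fourier_coeff_vanishes:
  assumes lt: "s < d" "t < d" "u < d" and distinct: "s \<noteq> t" "s \<noteq> u" "t \<noteq> u"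
    and l: "l < Q" "\<not> q s dvd l" "\<not> q t dvd l"
    and dets: "\<And>\<alpha> \<beta> \<gamma>. \<alpha> \<noteq> 0 \<Longrightarrow> \<beta> \<noteq> 0 \<Longrightarrow> \<gamma> \<noteq> 0 \<Longrightarrow>
      det (fourier_matrix d q V (z(s := \<alpha>, t := \<beta>, u := \<gamma>)) z1) =
      det (fourier_matrix d q Y (z(s := \<alpha>, t := \<beta>, u := \<gamma>)) z2)"
    and V: "\<And>a. \<not> int (q s) dvd a \<Longrightarrow> \<not> int (q t) dvd a \<Longrightarrow> fourier_coeff d q V a = 0"
    and Y: "\<forall>x\<in>carrier_vec d. Y x \<in> \<real>"
  shows "fourier_coeff d q Y (int l) = 0"
proof -
  define I where "I = {n. n < Q \<and> (\<forall>i\<in>{s, t, u}. int (q i) dvd int n)}"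
  define J where "J = {n. n < Q \<and> (\<forall>i\<in>{s, t, u}. int (q i) dvd int n - int l)}"
  let ?c = "\<lambda>V a. fourier_coeff d q V a"
  have eq: "(\<Sum>i\<in>I. \<Sum>j\<in>J. ?c V (int i - int j) * ?c V (int j - int i)) =
      (\<Sum>i\<in>I. \<Sum>j\<in>J. ?c Y (int i - int j) * ?c Y (int j - int i))"
    unfolding I_def J_def by (rule fourier_products_eq[OF lt distinct l dets])
  have "?c V (int i - int j) = 0" if "i \<in> I" "j \<in> J" for i j
  proof -
    have "\<not> int (q r) dvd int i - int j" if "r \<in> {s, t}" for r
    proof
      assume "int (q r) dvd int i - int j"
      moreover have "int (q r) dvd int i" "int (q r) dvd int j - int l"
        using \<open>i \<in> I\<close> \<open>j \<in> J\<close> that by (auto simp: I_def J_def)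
      ultimately have "int (q r) dvd int i - (int i - int j) - (int j - int l)"
        using dvd_diff by metis
      then show False using l that by auto
    qed
    then show ?thesis by (intro V) auto
  qed
  then have "(\<Sum>i\<in>I. \<Sum>j\<in>J. ?c Y (int i - int j) * ?c Y (int j - int i)) = 0"
    unfolding eq[symmetric] by simp
  moreover have "?c Y (int i - int j) * ?c Y (int j - int i) = of_real ((cmod (?c Y (int j - int i)))\<^sup>2)" for i j
    using fourier_coeff_minus[OF Y, of "int j - int i"] complex_norm_square[of "?c Y (int j - int i)"]
    by (simp add: mult.commute)
  ultimately have "of_real (\<Sum>i\<in>I. \<Sum>j\<in>J. (cmod (?c Y (int j - int i)))\<^sup>2) = (0 :: complex)"
    by (simp only: of_real_sum)
  then have zero: "(\<Sum>i\<in>I. \<Sum>j\<in>J. (cmod (?c Y (int j - int i)))\<^sup>2) = 0"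
    by (simp only: of_real_eq_0_iff)
  have fin: "finite I" "finite J" and mem: "0 \<in> I" "l \<in> J"
    using l Q_pos by (auto simp: I_def J_def)
  have "(\<Sum>j\<in>J. (cmod (?c Y (int j - int 0)))\<^sup>2) = 0"
    using zero fin mem(1) by (subst (asm) sum_nonneg_eq_0_iff) (auto intro: sum_nonneg)
  then have "(cmod (?c Y (int l - int 0)))\<^sup>2 = 0"
    using fin mem(2) by (subst (asm) sum_nonneg_eq_0_iff) auto
  then show ?thesis by simp
qed

end

section \<open>Separability in terms of Fourier coefficients\<close>

lemma block_end_le_block_start:
  assumes "1 \<le> m" "m < m'"
  shows "block_start D m + D m \<le> block_start D m'"
proof -
  have "block_start D m + D m = (\<Sum>j=1..<Suc m. D j)"
    using assms by (simp add: block_start_def)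
  also have "\<dots> \<le> (\<Sum>j=1..<m'. D j)" using assms by (intro sum_mono2) auto
  finally show ?thesis by (simp add: block_start_def)
qed

lemma block_disjoint:
  assumes "j \<in> block D m" "j \<in> block D m'" "1 \<le> m" "1 \<le> m'"
  shows "m = m'"
  using assms block_end_le_block_start[of m m' D] block_end_le_block_start[of m' m D]
  by (cases m m' rule: linorder_cases) (auto simp: block_def)

lemma block_end_le:
  assumes "1 \<le> m" "m \<le> r"
  shows "block_start D m + D m \<le> (\<Sum>j=1..r. D j)"
  using block_end_le_block_start[of m "Suc r" D] assms
  by (simp add: block_start_def atLeastLessThanSuc_atLeastAtMost)

lemma block_cover:
  assumes "j < (\<Sum>m=1..r. D m)"
  shows "\<exists>m\<in>{1..r}. j \<in> block D m"
  using assms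
proof (induction r)
  case (Suc r)
  show ?case
  proof (cases "j < (\<Sum>m=1..r. D m)")
    case True
    then show ?thesis using Suc.IH by force
  next
    case False
    then have "j \<in> block D (Suc r)"
      using Suc.prems by (simp add: block_def block_start_def atLeastLessThanSuc_atLeastAtMost)
    then show ?thesis by force
  qed
qed simp

lemma block_part_cong:
  assumes "\<And>j. j \<in> block D m \<Longrightarrow> x $ j = y $ j"
  shows "block_part D m x = block_part D m y"
  using assms by (intro eq_vecI) (auto simp: block_part_def block_def)

context coprime_periods begin

text \<open>A cyclic shift in direction \<open>j\<close> permutes the fundamental domain and leaves \<open>f\<close> unchanged, but
  multiplies the character by a root of unity different from \<open>1\<close>. The shift wraps around
  inside the fundamental domain, because the summands of a separable function need not be periodic.\<close>

lemma sum_character_eq_0: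
  assumes j: "j < d" and a: "\<not> int (q j) dvd a"
    and f: "\<And>x y. x \<in> W \<Longrightarrow> y \<in> W \<Longrightarrow> (\<forall>i<d. i \<noteq> j \<longrightarrow> x $ i = y $ i) \<Longrightarrow> f x = f y"
  shows "(\<Sum>x\<in>W. f x * cis (- (2 * pi * (of_int a * phase d q x)))) = 0"
proof -
  define shift where "shift c x = vec d (\<lambda>i. if i = j then (x $ j + c) mod int (q j) else x $ i)"
    for c :: int and x :: "int vec"
  have qj: "q j > 0" using j by (rule q_pos)
  have W: "shift c x \<in> W" if "x \<in> W" for c x
    using that qj by (auto simp: fundamental_domain_def shift_def zle_diff1_eq)
  have inv: "shift (- c) (shift c x) = x" if "x \<in> W" for c x
  proof (rule eq_vecI)
    fix i assume "i < dim_vec x"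
    then have i: "i < d" using that by (auto simp: fundamental_domain_def)
    have "((x $ j + c) mod int (q j) + - c) mod int (q j) = x $ j mod int (q j)"
      unfolding mod_add_left_eq by simp
    also have "\<dots> = x $ j" using that j by (simp add: fundamental_domain_def)
    finally show "shift (- c) (shift c x) $ i = x $ i" using i j by (simp add: shift_def)
  qed (use that in \<open>auto simp: fundamental_domain_def shift_def\<close>)
  have bij: "bij_betw (shift 1) W W"
    by (rule bij_betwI[where g = "shift (-1)"]) (use W inv[of _ 1] inv[of _ "-1"] in simp_all)
  define \<omega> where "\<omega> = cis (2 * pi * (of_int (- a) / q j))"
  have "\<omega> \<noteq> 1"
    unfolding \<omega>_def cis_eq_1_iff_Ints using fraction_Ints_iff[OF qj, of "- a"] a by simp
  have phase: "cis (- (2 * pi * (of_int a * phase d q (shift 1 x)))) =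
      \<omega> * cis (- (2 * pi * (of_int a * phase d q x)))" if "x \<in> W" for x
  proof -
    have "phase d q (shift 1 x) - phase d q x = (of_int ((x $ j + 1) mod int (q j)) - of_int (x $ j)) / q j"
    proof -
      have "phase d q (shift 1 x) - phase d q x =
          (\<Sum>i<d. if i = j then (of_int ((x $ j + 1) mod int (q j)) - of_int (x $ j)) / q j else 0)"
        unfolding phase_def sum_subtractf[symmetric]
        by (intro sum.cong refl) (auto simp: shift_def diff_divide_distrib)
      then show ?thesis using j by simp
    qed
    also have "\<dots> = 1 / q j - of_int ((x $ j + 1) div int (q j))"
    proof -
      have "(x $ j + 1) mod int (q j) - x $ j = 1 - int (q j) * ((x $ j + 1) div int (q j))"
        using mult_div_mod_eq[of "int (q j)" "x $ j + 1"] by linarith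
      then have "real_of_int ((x $ j + 1) mod int (q j)) - of_int (x $ j) =
          1 - q j * of_int ((x $ j + 1) div int (q j))"
        by (simp only: of_int_diff[symmetric] of_int_mult of_int_1 of_int_of_nat_eq) simp
      then show ?thesis using qj by (simp add: diff_divide_distrib)
    qed
    finally have eq: "phase d q (shift 1 x) =
        phase d q x + (1 / q j - of_int ((x $ j + 1) div int (q j)))" by linarith
    have "- (of_int a * phase d q (shift 1 x)) =
        (of_int (- a) / q j + - (of_int a * phase d q x)) + of_int (a * ((x $ j + 1) div int (q j)))"
      unfolding eq by (simp add: algebra_simps)
    then have "cis (2 * pi * - (of_int a * phase d q (shift 1 x))) =
        cis (2 * pi * (of_int (- a) / q j + - (of_int a * phase d q x)))"
      by (simp only: cis_turn_add_Ints[OF Ints_of_int])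
    then show ?thesis by (simp only: \<omega>_def cis_mult distrib_left mult_minus_right)
  qed
  have f_shift: "f (shift 1 x) = f x" if "x \<in> W" for x
    by (rule f[OF W[OF that] that]) (simp add: shift_def)
  let ?S = "\<Sum>x\<in>W. f x * cis (- (2 * pi * (of_int a * phase d q x)))"
  have "?S = (\<Sum>x\<in>W. f (shift 1 x) * cis (- (2 * pi * (of_int a * phase d q (shift 1 x)))))"
    by (rule sum.reindex_bij_betw[OF bij, symmetric])
  also have "\<dots> = \<omega> * ?S"
    unfolding sum_distrib_left by (intro sum.cong refl) (simp only: phase f_shift, simp only: mult.left_commute)
  finally have "(\<omega> - 1) * ?S = 0" by (simp add: left_diff_distrib)
  then show ?thesis using \<open>\<omega> \<noteq> 1\<close> by simp
qed

text \<open>Each summand of \<open>V\<close> depends on only one block besides the last, so it is constant in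
  direction \<open>s\<close> or in direction \<open>t\<close>, and the character sums to \<open>0\<close> in that direction.\<close>

lemma fourier_coeff_separable:
  assumes V: "separable D r V" and d: "d = (\<Sum>j=1..r. D j)"
    and im: "1 \<le> i" "i < m" "m \<le> r - 1" and s: "s \<in> block D i" and t: "t \<in> block D m"
    and a: "\<not> int (q s) dvd a" "\<not> int (q t) dvd a"
  shows "fourier_coeff d q V a = 0"
proof -
  obtain Vs where Vs: "\<And>n. n \<in> carrier_vec d \<Longrightarrow>
      V n = (\<Sum>m=1..r-1. Vs m (block_part D m n @\<^sub>v block_part D r n))"
    using V unfolding separable_def d by blast
  let ?e = "\<lambda>x. cis (- (2 * pi * (of_int a * phase d q x)))"
  let ?v = "\<lambda>m' x. Vs m' (block_part D m' x @\<^sub>v block_part D r x)"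
  have "(\<Sum>x\<in>W. V x * ?e x) = (\<Sum>x\<in>W. \<Sum>m'=1..r-1. ?v m' x * ?e x)"
  proof (rule sum.cong[OF refl])
    fix x assume "x \<in> W"
    then have "x \<in> carrier_vec d" by (simp add: fundamental_domain_def)
    then show "V x * ?e x = (\<Sum>m'=1..r-1. ?v m' x * ?e x)" by (simp only: Vs sum_distrib_right)
  qed
  also have "\<dots> = (\<Sum>m'=1..r-1. \<Sum>x\<in>W. ?v m' x * ?e x)" by (rule sum.swap)
  also have "\<dots> = 0"
  proof (rule sum.neutral, rule ballI)
    fix m' assume m': "m' \<in> {1..r-1}"
    obtain j b where j: "j \<in> block D b" "b \<noteq> m'" "1 \<le> b" "b < r" "\<not> int (q j) dvd a"
    proof (cases "m' = i")
      case True
      then show ?thesis using that[of t m] im t a by auto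
    next
      case False
      then show ?thesis using that[of s i] im s a by auto
    qed
    have jd: "j < d" using j block_end_le[of b r D] unfolding d block_def by auto
    have notin: "j \<notin> block D m'" "j \<notin> block D r"
      using block_disjoint[OF j(1), of m'] block_disjoint[OF j(1), of r] j(2-4) m' by auto
    have "m' \<le> r" using m' by auto
    then have in_d: "k < d" if "k \<in> block D m' \<or> k \<in> block D r" for k
      using that m' j block_end_le[of m' r D] block_end_le[of r r D] unfolding d block_def by auto
    show "(\<Sum>x\<in>W. ?v m' x * ?e x) = 0"
    proof (rule sum_character_eq_0[OF jd j(5)])
      fix x y :: "int vec" assume eq: "\<forall>k<d. k \<noteq> j \<longrightarrow> x $ k = y $ k"
      have "x $ k = y $ k" if "k \<in> block D m' \<or> k \<in> block D r" for k
        using eq in_d[OF that] that notin by blast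
      then have "block_part D m' x = block_part D m' y" "block_part D r x = block_part D r y"
        by (auto intro!: block_part_cong)
      then show "?v m' x = ?v m' y" by simp
    qed
  qed
  finally show ?thesis by (simp add: fourier_coeff_def)
qed

lemma phase_cong_mod:
  assumes "\<And>j. j < d \<Longrightarrow> int (q j) dvd a * (x $ j - y $ j)"
  shows "cis (2 * pi * (of_int a * phase d q x)) = cis (2 * pi * (of_int a * phase d q y))"
proof -
  have "of_int a * phase d q x - of_int a * phase d q y =
      (\<Sum>j<d. of_int (a * (x $ j - y $ j)) / of_nat (q j))"
    unfolding phase_def sum_distrib_left sum_subtractf[symmetric]
    by (intro sum.cong refl) (simp add: right_diff_distrib diff_divide_distrib)
  also have "\<dots> \<in> \<int>"
    using assms q_pos fraction_Ints_iff by (intro Ints_sum) blast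
  finally show ?thesis by (simp only: cis_turn_eq_iff)
qed

lemma fourier_inversion:
  assumes Y: "periodic d q Y" and x: "x \<in> carrier_vec d"
  shows "Y x = (\<Sum>n<Q. fourier_coeff d q Y (int n) * cis (2 * pi * (of_int (int n) * phase d q x)))"
proof -
  let ?y = "residue_point d q x"
  have y: "?y \<in> W" using q_pos
    by (auto simp: fundamental_domain_def residue_point_def zle_diff1_eq)
  have "x = ?y + (x - ?y)" using x by (intro eq_vecI) (auto simp: residue_point_def)
  moreover have "x - ?y \<in> period_lattice d q"
    using x by (auto simp: period_lattice_def residue_point_def dvd_minus_mod)
  ultimately have "Y x = Y ?y"
    using Y y unfolding periodic_def fundamental_domain_def by (metis (no_types, lifting) mem_Collect_eq)
  also have "\<dots> = (\<Sum>n<Q. fourier_coeff d q Y (int n) * cis (2 * pi * (of_int (int n) * phase d q ?y)))"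
    using shifted_fourier_inversion[OF y, of Y 0] by simp
  also have "\<dots> = (\<Sum>n<Q. fourier_coeff d q Y (int n) * cis (2 * pi * (of_int (int n) * phase d q x)))"
    using x by (intro sum.cong refl arg_cong2[of _ _ _ _ "(*)"] phase_cong_mod dvd_mult)
      (auto simp: residue_point_def mod_eq_dvd_iff[symmetric])
  finally show ?thesis .
qed

text \<open>If \<open>Y\<close> has a non-zero coefficient at \<open>n\<close>, there is a block \<open>M n\<close> such that the
  character with frequency \<open>n\<close> depends only on the coordinates in that block and in the last one.
  Grouping the Fourier series of \<open>Y\<close> by \<open>M n\<close> gives the decomposition.\<close>

lemma separableI_fourier_coeff:
  assumes Y: "periodic d q Y" and d: "d = (\<Sum>j=1..r. D j)" and r: "r \<ge> 2"
    and vanish: "\<And>i m s t n. 1 \<le> i \<Longrightarrow> i < m \<Longrightarrow> m \<le> r - 1 \<Longrightarrow> s \<in> block D i \<Longrightarrow> t \<in> block D m \<Longrightarrow>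
      n < Q \<Longrightarrow> \<not> q s dvd n \<Longrightarrow> \<not> q t dvd n \<Longrightarrow> fourier_coeff d q Y (int n) = 0"
  shows "separable D r Y"
proof -
  let ?c = "\<lambda>n. fourier_coeff d q Y (int n)"
  have "\<exists>m. m \<in> {1..r-1} \<and> (?c n \<noteq> 0 \<longrightarrow> (\<forall>i\<in>{1..r-1}. i \<noteq> m \<longrightarrow> (\<forall>j\<in>block D i. q j dvd n)))"
    if n: "n < Q" for n
  proof (cases "\<exists>m\<in>{1..r-1}. \<exists>t\<in>block D m. \<not> q t dvd n")
    case True
    then obtain m t where m: "m \<in> {1..r-1}" "t \<in> block D m" "\<not> q t dvd n" by blast
    have "q j dvd n" if "?c n \<noteq> 0" "i \<in> {1..r-1}" "i \<noteq> m" "j \<in> block D i" for i j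
      using that m n vanish[of i m j t n] vanish[of m i t j n]
      by (cases i m rule: linorder_cases) auto
    then show ?thesis using m(1) by blast
  next
    case False
    \<comment> \<open>the character depends on the last block only and may go to any summand\<close>
    then show ?thesis using r by (intro exI[of _ 1]) auto
  qed
  then obtain M where M: "\<And>n. n < Q \<Longrightarrow> M n \<in> {1..r-1}"
    and dvd: "\<And>n i j. n < Q \<Longrightarrow> ?c n \<noteq> 0 \<Longrightarrow> i \<in> {1..r-1} \<Longrightarrow> i \<noteq> M n \<Longrightarrow> j \<in> block D i \<Longrightarrow> q j dvd n"
    by metis
  \<comment> \<open>A summand receives only the two blocks of coordinates; the remaining ones are filled up with
    \<open>0\<close>, which does not change the characters that occur in it.\<close>
  define emb where "emb m v = vec d (\<lambda>j. if j \<in> block D m then v $ (j - block_start D m)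
      else if j \<in> block D r then v $ (D m + (j - block_start D r)) else 0)" for m and v :: "int vec"
  define Vs where "Vs m v = (\<Sum>n | n < Q \<and> M n = m. ?c n * cis (2 * pi * (of_int (int n) * phase d q (emb m v))))"
    for m v
  have "Y x = (\<Sum>m=1..r-1. Vs m (block_part D m x @\<^sub>v block_part D r x))" if x: "x \<in> carrier_vec d" for x
  proof -
    let ?f = "\<lambda>n. ?c n * cis (2 * pi * (of_int (int n) * phase d q x))"
    have emb: "emb m (block_part D m x @\<^sub>v block_part D r x) $ j = x $ j"
      if "j < d" "j \<in> block D m \<or> j \<in> block D r" for m j
      using that by (auto simp: emb_def block_part_def block_def)
    have reconstruct: "?c n * cis (2 * pi * (of_int (int n) * phase d q (emb (M n) (block_part D (M n) x @\<^sub>v block_part D r x)))) = ?f n"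
      if n: "n < Q" for n
    proof (cases "?c n = 0")
      case False
      have "int (q j) dvd int n * (emb (M n) (block_part D (M n) x @\<^sub>v block_part D r x) $ j - x $ j)"
        if j: "j < d" for j
      proof (cases "j \<in> block D (M n) \<or> j \<in> block D r")
        case True
        then show ?thesis using emb[OF j] by simp
      next
        case other: False
        obtain i where i: "i \<in> {1..r}" "j \<in> block D i" using block_cover j d by blast
        then have "i \<noteq> r" "i \<noteq> M n" using other by blast+
        then have "q j dvd n" using i by (intro dvd[OF n False, of i]) auto
        then show ?thesis by simp
      qed
      from phase_cong_mod[OF this] show ?thesis by (simp only:)
    qed simp
    have "Y x = (\<Sum>n<Q. ?f n)" by (rule fourier_inversion[OF Y x])
    also have "\<dots> = (\<Sum>m=1..r-1. \<Sum>n | n \<in> {..<Q} \<and> M n = m. ?f n)"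
      using M by (intro sum.group[symmetric]) auto
    also have "\<dots> = (\<Sum>m=1..r-1. Vs m (block_part D m x @\<^sub>v block_part D r x))"
      unfolding Vs_def by (intro sum.cong refl) (use reconstruct in force)+
    finally show ?thesis .
  qed
  then show ?thesis unfolding separable_def d by blast
qed

end

section \<open>Rigidity of separability\<close>

theorem theorem3p4:
  fixes r d :: nat and D q :: "nat \<Rightarrow> nat" and V Y :: "int vec \<Rightarrow> complex"
  assumes "r \<ge> 3"
    and "\<forall>j\<in>{1..r}. D j \<ge> 1"
    and "d = (\<Sum>j=1..r. D j)"
    and "d \<ge> 3"
    and "\<forall>j<d. q j > 0"
    and "\<forall>i<d. \<forall>j<d. i \<noteq> j \<longrightarrow> coprime (q i) (q j)"
    and "periodic d q V" and "periodic d q Y"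
    and "\<forall>n\<in>carrier_vec d. V n \<in> \<real>" and "\<forall>n\<in>carrier_vec d. Y n \<in> \<real>"
    and "separable D r V"
    and "\<forall>i m s t. 1 \<le> i \<and> i < m \<and> m \<le> r - 1 \<and> s \<in> block D i \<and> t \<in> block D m \<longrightarrow>
           (\<exists>(z1::complex) (z2::complex) S.
              S \<subseteq> {..<d} \<and> s \<in> S \<and> t \<in> S \<and> card S \<ge> 3 \<and>
              partially_fermi_isospectral d q S z1 z2 V Y)"
  shows "separable D r Y"
proof -
  interpret coprime_periods d q using assms(5,6) by unfold_locales blast+
  show ?thesis
  proof (rule separableI_fourier_coeff[OF assms(8,3)])
    fix i m s t n
    assume im: "1 \<le> i" "i < m" "m \<le> r - 1" and s: "s \<in> block D i" and t: "t \<in> block D m"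
      and n: "n < Q" "\<not> q s dvd n" "\<not> q t dvd n"
    obtain z1 z2 S where S: "S \<subseteq> {..<d}" "s \<in> S" "t \<in> S" "card S \<ge> 3"
      and iso: "partially_fermi_isospectral d q S z1 z2 V Y"
      using assms(12)[rule_format, of i m s t] im s t by blast
    have "\<not> S \<subseteq> {s, t}"
    proof
      assume "S \<subseteq> {s, t}"
      then have "card S \<le> card {s, t}" by (intro card_mono) auto
      also have "\<dots> \<le> 2" by (simp add: card_insert_if)
      finally show False using S(4) by simp
    qed
    then obtain u where u: "u \<in> S" "s \<noteq> u" "t \<noteq> u" by blast
    have st: "s \<noteq> t" using block_disjoint[of s D i m] im s t by auto
    obtain z where dets: "\<And>\<alpha> \<beta> \<gamma>. \<alpha> \<noteq> 0 \<Longrightarrow> \<beta> \<noteq> 0 \<Longrightarrow> \<gamma> \<noteq> 0 \<Longrightarrow>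
        det (fourier_matrix d q V (z(s := \<alpha>, t := \<beta>, u := \<gamma>)) z1) =
        det (fourier_matrix d q Y (z(s := \<alpha>, t := \<beta>, u := \<gamma>)) z2)"
      using isospectral_imp_det_eq[OF iso S(2,3) u(1) S(1) st u(2,3)] by blast
    show "fourier_coeff d q Y (int n) = 0"
    proof (rule fourier_coeff_vanishes[OF _ _ _ st u(2,3) n dets _ assms(10)])
      show "s < d" "t < d" "u < d" using S u by auto
      show "fourier_coeff d q V a = 0" if "\<not> int (q s) dvd a" "\<not> int (q t) dvd a" for a
        using fourier_coeff_separable[OF assms(11,3) im s t that] .
    qed
  qed (use assms(1) in auto)
qed

end
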